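(* Let $n\ge4$, $i\in\{1,2\}$, $m\ge1$ and $A=(a_{p,q})\in B^{i,m}$ (with $a_{2,q}:=0$ if $i=1$). Define $\Sigma_n:=-a_{2,n}$, $\chi_n:=1$, and recursively for $k=n-1,n-2,\dots,2$: $\Sigma_k:=a_{1,k+1}+(1-\chi_{k+1})\Sigma_{k+1}-a_{2,k}$, $\chi_k:=1$ if $\Sigma_k<0$ and $\chi_k:=0$ if $\Sigma_k\ge0$. With the operators $X_\ell$ ($2\le\ell\le n$) and $G$ defined as follows: $c_\ell=\sum_{p=1}^i a_{p,\ell}$, $X_\ell=(f_\ell^{c_\ell}\circ f_{\ell-1}^{c_\ell}\circ\cdots\circ f_{i+1}^{c_\ell})\circ D_\ell$ where $D_\ell=f_2^{a_{2,\ell}}$ if $i=2$ and $D_\ell=\mathrm{id}$ if $i=1$, and $G=f_1^{d}\circ\cdots\circ f_i^{d}$ with $d=\sum_{r=i}^n a_{1,r}$, let for $2\le k\le n$ $$T^{(k)}:=X_k\circ X_{k+1}\circ\cdots\circ X_n\circ G\,(T^{(0)})\in\mathrm{SSYT}(m\omega_i),$$ the operators acting on tableaux. Then these tableaux are defined and, in matrix notation, $T^{(k)}_{s,t}$ equals: - $m-\sum_{j=i}^n a_{1,j}$ if $(s,t)=(i-1,1)$; - $\sum_{j=2}^k a_{1,j}+(1-\chi_k)\Sigma_k$ if $(s,t)=(i-1,2)$; - $m-\sum_{j=i}^n a_{1,j}+\sum_{j=k}^n\chi_j\Sigma_j$ if $(s,t)=(i,1)$; - $\sum_{j=i}^{k-1}a_{1,j}$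 if $(s,t)=(i,2)$ and $k\ge i+1$; - $a_{2,t-1}+\chi_{t-1}\Sigma_{t-1}$ if $s=i-1$ and $k+1\le t\le n$; - $a_{1,t+i-2}-\chi_{t+i-2}\Sigma_{t+i-2}$ if $s=i$ and $k-i+2\le t\le n-i+2$; - $0$ for all other $(s,t)$, (cases with $s=i-1$ being vacuous when $i=1$). In particular $\varphi_{i,m}(A)=T^{(2)}$.
   Context: $B^{i,m}$ is the set of arrays $A=(a_{p,q})$ of non-negative integers indexed by $1\le p\le i$ (column index), $i\le q\le n$ (row index), with $\sum_{r=1}^n a_{\beta(r)}\le m$ for every Dyck path $\beta$ (positions $\beta(1)=(1,i),\dots,\beta(n)=(i,n)$ with $\beta(r+1)\in\{(a,b+1),(a+1,b)\}$ if $\beta(r)=(a,b)$); $a_{p,q}=0$ outside this range. It carries a crystal structure (Kus's polytope model of the Kirillov–Reshetikhin crystal; the zero array is its highest weight element). $\mathrm{SSYT}(m\omega_i)$: semistandard Young tableaux of rectangular shape with $i$ rows and $m$ columns, entries in $\{1,\dots,n+1\}$; row $s$ has entries in $[s,n-i+s+1]$. Crystal operators on tableaux, $1\le j\le n$: read the tableau left to right along rows, starting with the bottom row and moving up; ignoring letters other than $j,j+1$, repeatedly cancel a letter $j+1$ immediately followed by a letter $j$ until the remaining letters are $j^a(j+1)^b$; $f_j$ changes the rightmost unpaired $j$ to $j+1$ (undefined if $a=0$), $e_j$ changes the leftmost unpaired $j+1$ to $j$. $f_j^c$ means $c$-fold application, $\circ$ is applied right to left. $T^{(0)}$ is the tableau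 whose row $s$ has all entries $s$. Matrix notation: for a tableau $T$, $T_{s,t}$ ($1\le s\le i$, $1\le t\le n-i+2$) is the number of entries equal to $s+t-1$ in row $s$ of $T$. $\varphi_{i,m}:B^{i,m}\to\mathrm{SSYT}(m\omega_i)$ is the crystal isomorphism (the unique bijection commuting with all $f_j,e_j$, $1\le j\le n$; it also respects the affine crystal structures), sending the zero array to $T^{(0)}$; on $B^{i,m}$ the operators $f_j$ are those of the polytope model, under which $P:=X_2\circ\cdots\circ X_n\circ G$ sends the zero array to $A$. *)

theory Defs
  imports Main
begin

section \<open>The polytope model of the Kirillov--Reshetikhin crystal\<close>

text \<open>
  An array \<open>A\<close> is indexed as \<open>A p q\<close> with column index \<open>p\<close> and row index \<open>q\<close>.
\<close>

definition dyck_path :: "nat \<Rightarrow> nat \<Rightarrow> (nat \<Rightarrow> nat \<times> nat) \<Rightarrow> bool" where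
  "dyck_path n i \<beta> \<longleftrightarrow> \<beta> 1 = (1, i) \<and> \<beta> n = (i, n) \<and>
     (\<forall>r\<in>{1..<n}. \<beta> (r + 1) = (fst (\<beta> r), snd (\<beta> r) + 1) \<or>
                  \<beta> (r + 1) = (fst (\<beta> r) + 1, snd (\<beta> r)))"

definition kr_arrays :: "nat \<Rightarrow> nat \<Rightarrow> nat \<Rightarrow> (nat \<Rightarrow> nat \<Rightarrow> nat) set" where
  "kr_arrays n i m =
     {A. (\<forall>p q. \<not> (1 \<le> p \<and> p \<le> i \<and> i \<le> q \<and> q \<le> n) \<longrightarrow> A p q = 0) \<and>
         (\<forall>\<beta>. dyck_path n i \<beta> \<longrightarrow> (\<Sum>r = 1..n. A (fst (\<beta> r)) (snd (\<beta> r))) \<le> m)}"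

definition argmax_set :: "('a \<Rightarrow> nat) \<Rightarrow> 'a set \<Rightarrow> 'a set" where
  "argmax_set F S = {x \<in> S. \<forall>y\<in>S. F y \<le> F x}"

text \<open>
  Kus's Kashiwara operators. The entry \<open>A p q\<close> contributes \<open>-(\<alpha>\<^sub>p + \<dots> + \<alpha>\<^sub>q)\<close> to the
  weight \<open>m\<omega>\<^sub>i - \<dots>\<close>, so lowering by \<open>\<alpha>\<^sub>l\<close> moves a unit from row \<open>l - 1\<close> to row \<open>l\<close> if \<open>l > i\<close>,
  moves a unit from column \<open>l + 1\<close> to column \<open>l\<close> if \<open>l < i\<close>, and increases \<open>A i i\<close> if \<open>l = i\<close>.
  The column (resp. row) where the unit is moved is an extremal one at which a Dyck path
  with maximal sum can change from row \<open>l - 1\<close> to row \<open>l\<close> (resp. from column \<open>l\<close> to column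
  \<open>l + 1\<close>).
\<close>

definition row_cross :: "nat \<Rightarrow> nat \<Rightarrow> (nat \<Rightarrow> nat \<Rightarrow> nat) \<Rightarrow> nat set" where
  "row_cross i l A =
     argmax_set (\<lambda>p. (\<Sum>j = 1..p. A j (l - 1)) + (\<Sum>j = p..i. A j l)) {1..i}"

definition col_cross :: "nat \<Rightarrow> nat \<Rightarrow> nat \<Rightarrow> (nat \<Rightarrow> nat \<Rightarrow> nat) \<Rightarrow> nat set" where
  "col_cross n i l A =
     argmax_set (\<lambda>q. (\<Sum>j = i..q. A l j) + (\<Sum>j = q..n. A (l + 1) j)) {i..n}"

text \<open>
  \<open>kr_phi\<close> and \<open>kr_eps\<close> are the string lengths of an element of \<open>kr_arrays n i m\<close>; there none
  of the subtractions truncates.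
\<close>

definition kr_phi :: "nat \<Rightarrow> nat \<Rightarrow> nat \<Rightarrow> nat \<Rightarrow> (nat \<Rightarrow> nat \<Rightarrow> nat) \<Rightarrow> nat" where
  "kr_phi n i m l A =
     (if l = i then m - ((\<Sum>j = 1..<i. A j i) + (\<Sum>j = i..n. A i j))
      else if i < l then
        (let p = Min (row_cross i l A) in (\<Sum>j = 1..p. A j (l - 1)) - (\<Sum>j = 1..<p. A j l))
      else
        (let q = Max (col_cross n i l A) in
           (\<Sum>j = q..n. A (l + 1) j) - (\<Sum>j = q + 1..n. A l j)))"

definition kr_eps :: "nat \<Rightarrow> nat \<Rightarrow> nat \<Rightarrow> (nat \<Rightarrow> nat \<Rightarrow> nat) \<Rightarrow> nat" where
  "kr_eps n i l A =
     (if l = i then A i i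
      else if i < l then
        (let p = Max (row_cross i l A) in (\<Sum>j = p..i. A j l) - (\<Sum>j = p + 1..i. A j (l - 1)))
      else
        (let q = Min (col_cross n i l A) in
           (\<Sum>j = i..q. A l j) - (\<Sum>j = i..<q. A (l + 1) j)))"

definition upd :: "(nat \<Rightarrow> nat \<Rightarrow> nat) \<Rightarrow> nat \<Rightarrow> nat \<Rightarrow> nat \<Rightarrow> (nat \<Rightarrow> nat \<Rightarrow> nat)" where
  "upd A p q v = A(p := (A p)(q := v))"

definition kr_f :: "nat \<Rightarrow> nat \<Rightarrow> nat \<Rightarrow> nat \<Rightarrow> (nat \<Rightarrow> nat \<Rightarrow> nat) \<Rightarrow> (nat \<Rightarrow> nat \<Rightarrow> nat) option" where
  "kr_f n i m l A =
     (if kr_phi n i m l A = 0 then None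
      else Some
        (if l = i then upd A i i (A i i + 1)
         else if i < l then
           (let p = Min (row_cross i l A) in
              upd (upd A p (l - 1) (A p (l - 1) - 1)) p l (A p l + 1))
         else
           (let q = Max (col_cross n i l A) in
              upd (upd A (l + 1) q (A (l + 1) q - 1)) l q (A l q + 1))))"

definition kr_e :: "nat \<Rightarrow> nat \<Rightarrow> nat \<Rightarrow> (nat \<Rightarrow> nat \<Rightarrow> nat) \<Rightarrow> (nat \<Rightarrow> nat \<Rightarrow> nat) option" where
  "kr_e n i l A =
     (if kr_eps n i l A = 0 then None
      else Some
        (if l = i then upd A i i (A i i - 1)
         else if i < l then
           (let p = Max (row_cross i l A) in
              upd (upd A p (l - 1) (A p (l - 1) + 1)) p l (A p l - 1))
         else
           (let q = Min (col_cross n i l A) in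
              upd (upd A (l + 1) q (A (l + 1) q + 1)) l q (A l q - 1))))"


section \<open>The tableau crystal\<close>

text \<open>
  A tableau is a function \<open>T\<close> with \<open>T r c\<close> the entry in row \<open>r\<close> (row 1 on top) and column \<open>c\<close>,
  and value 0 outside the shape.
\<close>

definition ssyt :: "nat \<Rightarrow> nat \<Rightarrow> nat \<Rightarrow> (nat \<Rightarrow> nat \<Rightarrow> nat) set" where
  "ssyt n i m =
     {T. (\<forall>r c. \<not> (1 \<le> r \<and> r \<le> i \<and> 1 \<le> c \<and> c \<le> m) \<longrightarrow> T r c = 0) \<and>
         (\<forall>r\<in>{1..i}. \<forall>c\<in>{1..m}. T r c \<in> {1..n + 1}) \<and>
         (\<forall>r\<in>{1..i}. \<forall>c\<in>{1..<m}. T r c \<le> T r (c + 1)) \<and>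
         (\<forall>r\<in>{1..<i}. \<forall>c\<in>{1..m}. T r c < T (r + 1) c)}"

definition reading_cells :: "nat \<Rightarrow> nat \<Rightarrow> (nat \<times> nat) list" where
  "reading_cells i m = concat (map (\<lambda>r. map (\<lambda>c. (r, c)) [1..<m + 1]) (rev [1..<i + 1]))"

text \<open>
  For a list \<open>xs\<close> of positions whose letters, given by \<open>w\<close>, are all \<open>j\<close> or \<open>j + 1\<close>,
  \<open>unpaired w j xs\<close> lists the positions that survive the repeated cancellation of a letter
  \<open>j + 1\<close> immediately followed by a letter \<open>j\<close>.
\<close>

fun unpaired :: "('a \<Rightarrow> nat) \<Rightarrow> nat \<Rightarrow> 'a list \<Rightarrow> 'a list" where
  "unpaired w j [] = []"
| "unpaired w j (x # xs) =
     (case unpaired w j xs of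
        [] \<Rightarrow> [x]
      | y # ys \<Rightarrow> if w x = j + 1 \<and> w y = j then ys else x # y # ys)"

definition unpaired_cells :: "nat \<Rightarrow> nat \<Rightarrow> nat \<Rightarrow> (nat \<Rightarrow> nat \<Rightarrow> nat) \<Rightarrow> (nat \<times> nat) list" where
  "unpaired_cells i m j T =
     (let w = (\<lambda>(r, c). T r c)
      in unpaired w j (filter (\<lambda>x. w x = j \<or> w x = j + 1) (reading_cells i m)))"

definition tab_f :: "nat \<Rightarrow> nat \<Rightarrow> nat \<Rightarrow> (nat \<Rightarrow> nat \<Rightarrow> nat) \<Rightarrow> (nat \<Rightarrow> nat \<Rightarrow> nat) option" where
  "tab_f i m j T =
     (let xs = filter (\<lambda>(r, c). T r c = j) (unpaired_cells i m j T)
      in if xs = [] then None else Some (upd T (fst (last xs)) (snd (last xs)) (j + 1)))"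

definition tab_e :: "nat \<Rightarrow> nat \<Rightarrow> nat \<Rightarrow> (nat \<Rightarrow> nat \<Rightarrow> nat) \<Rightarrow> (nat \<Rightarrow> nat \<Rightarrow> nat) option" where
  "tab_e i m j T =
     (let xs = filter (\<lambda>(r, c). T r c = j + 1) (unpaired_cells i m j T)
      in if xs = [] then None else Some (upd T (fst (hd xs)) (snd (hd xs)) j))"

definition highest_tab :: "nat \<Rightarrow> nat \<Rightarrow> nat \<Rightarrow> nat \<Rightarrow> nat" where
  "highest_tab i m = (\<lambda>r c. if 1 \<le> r \<and> r \<le> i \<and> 1 \<le> c \<and> c \<le> m then r else 0)"

definition tab_matrix :: "nat \<Rightarrow> (nat \<Rightarrow> nat \<Rightarrow> nat) \<Rightarrow> nat \<Rightarrow> nat \<Rightarrow> nat" where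
  "tab_matrix m T s t = card {c \<in> {1..m}. T s c = s + t - 1}"


section \<open>Crystal isomorphisms\<close>

definition crystal_iso ::
  "nat \<Rightarrow> nat \<Rightarrow> nat \<Rightarrow> ((nat \<Rightarrow> nat \<Rightarrow> nat) \<Rightarrow> (nat \<Rightarrow> nat \<Rightarrow> nat)) \<Rightarrow> bool" where
  "crystal_iso n i m \<phi> \<longleftrightarrow>
     bij_betw \<phi> (kr_arrays n i m) (ssyt n i m) \<and>
     (\<forall>A\<in>kr_arrays n i m. \<forall>j\<in>{1..n}.
        map_option \<phi> (kr_f n i m j A) = tab_f i m j (\<phi> A) \<and>
        map_option \<phi> (kr_e n i j A) = tab_e i m j (\<phi> A))"


section \<open>The operators determined by an array\<close>

definition f_pow :: "nat \<Rightarrow> nat \<Rightarrow> nat \<Rightarrow> nat \<Rightarrow>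
    (nat \<Rightarrow> nat \<Rightarrow> nat) option \<Rightarrow> (nat \<Rightarrow> nat \<Rightarrow> nat) option" where
  "f_pow i m j c = (\<lambda>x. Option.bind x (tab_f i m j)) ^^ c"

text \<open>
  \<open>fold h [x\<^sub>1, \<dots>, x\<^sub>r]\<close> is \<open>h x\<^sub>r \<circ> \<dots> \<circ> h x\<^sub>1\<close>, so each list names the operators in the order in
  which they are applied.
\<close>

definition op_D :: "nat \<Rightarrow> nat \<Rightarrow> (nat \<Rightarrow> nat \<Rightarrow> nat) \<Rightarrow> nat \<Rightarrow>
    (nat \<Rightarrow> nat \<Rightarrow> nat) option \<Rightarrow> (nat \<Rightarrow> nat \<Rightarrow> nat) option" where
  "op_D i m A l = (if i = 2 then f_pow i m 2 (A 2 l) else id)"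

definition op_X :: "nat \<Rightarrow> nat \<Rightarrow> (nat \<Rightarrow> nat \<Rightarrow> nat) \<Rightarrow> nat \<Rightarrow>
    (nat \<Rightarrow> nat \<Rightarrow> nat) option \<Rightarrow> (nat \<Rightarrow> nat \<Rightarrow> nat) option" where
  "op_X i m A l = fold (\<lambda>j. f_pow i m j (\<Sum>p = 1..i. A p l)) [i + 1..<l + 1] \<circ> op_D i m A l"

definition op_G :: "nat \<Rightarrow> nat \<Rightarrow> nat \<Rightarrow> (nat \<Rightarrow> nat \<Rightarrow> nat) \<Rightarrow>
    (nat \<Rightarrow> nat \<Rightarrow> nat) option \<Rightarrow> (nat \<Rightarrow> nat \<Rightarrow> nat) option" where
  "op_G n i m A = fold (\<lambda>j. f_pow i m j (\<Sum>r = i..n. A 1 r)) (rev [1..<i + 1])"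

definition tab_T :: "nat \<Rightarrow> nat \<Rightarrow> nat \<Rightarrow> (nat \<Rightarrow> nat \<Rightarrow> nat) \<Rightarrow> nat \<Rightarrow>
    (nat \<Rightarrow> nat \<Rightarrow> nat) option" where
  "tab_T n i m A k =
     fold (op_X i m A) (rev [k..<n + 1]) (op_G n i m A (Some (highest_tab i m)))"

function \<Sigma>_seq :: "nat \<Rightarrow> (nat \<Rightarrow> nat \<Rightarrow> nat) \<Rightarrow> nat \<Rightarrow> int"
  and \<chi>_seq :: "nat \<Rightarrow> (nat \<Rightarrow> nat \<Rightarrow> nat) \<Rightarrow> nat \<Rightarrow> int" where
  "\<Sigma>_seq n A k =
     (if n \<le> k then - int (A 2 n)
      else int (A 1 (k + 1)) + (1 - \<chi>_seq n A (k + 1)) * \<Sigma>_seq n A (k + 1) - int (A 2 k))"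
| "\<chi>_seq n A k = (if n \<le> k then 1 else if \<Sigma>_seq n A k < 0 then 1 else 0)"
  by pat_completeness auto
termination
  by (relation "measure (\<lambda>x. case x of Inl (n, A, k) \<Rightarrow> 2 * (n - k)
                                     | Inr (n, A, k) \<Rightarrow> 2 * (n - k) + 1)") auto

declare \<Sigma>_seq.simps [simp del] and \<chi>_seq.simps [simp del]

end

theory Submission
  imports Defs
begin

text \<open>
  A row of a tableau is encoded by its cumulative count \<open>X\<close>, where \<open>X v\<close> is the number of entries
  \<open>\<le> v\<close>; on a tableau with at most two rows, \<open>f\<^sub>j\<close> lowers the count of one row at \<open>j\<close> by one.
  Let \<open>pos k = max 0 \<Sigma>\<^sub>k\<close>, let \<open>neg_sum k\<close> be the sum of \<open>min 0 \<Sigma>\<^sub>j\<close> over \<open>j \<ge> k\<close>, let \<open>psum k\<close> be the sum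
  of \<open>A 1 j\<close> over \<open>j \<le> k\<close>, and let \<open>C = m - psum n\<close>. Up to their first values, the cumulative counts
  of the \<open>k\<close>-th tableau are \<open>F (max v k)\<close> in row \<open>i - 1\<close> and \<open>L (max v k)\<close> in row \<open>i\<close>, where
  \<open>F v = C + psum v + pos v\<close> and \<open>L v = C + neg_sum v + psum (v - 1)\<close>. The recursion for \<open>\<Sigma>\<close> says how
  many steps of each power of \<open>f\<^sub>j\<close> happen in row \<open>i - 1\<close> before row \<open>i\<close> takes over. That row \<open>i\<close>
  never runs out of entries \<open>i\<close> means \<open>0 \<le> C + neg_sum k\<close>, which is the Dyck path inequality at the
  first \<open>j \<ge> k\<close> with \<open>\<Sigma>\<^sub>j < 0\<close>.

  A crystal isomorphism maps the zero array to the unique highest weight tableau, so the last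
  tableau is the image of the array which the same operators produce from the zero array. In the
  polytope model each power of \<open>f\<^sub>j\<close> in \<open>X\<^sub>l\<close> moves the future row \<open>l\<close> of \<open>A\<close> from row \<open>j - 1\<close> to row \<open>j\<close>,
  so that array is \<open>A\<close>.
\<close>

section \<open>Rows as cumulative counts\<close>

text \<open>The generalised inverse of the count: the letter in column \<open>c\<close> of the
  weakly increasing row with count \<open>X\<close>. Counts are integers, so that differences and
  decrements never truncate.\<close>

definition entry :: "(nat \<Rightarrow> int) \<Rightarrow> nat \<Rightarrow> nat" where
  "entry X c = (LEAST v. int c \<le> X v)"

definition cumulative :: "nat \<Rightarrow> nat \<Rightarrow> (nat \<Rightarrow> int) \<Rightarrow> bool" where
  "cumulative N m X \<longleftrightarrow> mono X \<and> X 0 = 0 \<and> (\<forall>v\<ge>N. X v = int m)"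

text \<open>With \<open>i = 2\<close> the upper row is \<open>X\<close> and the lower row
  \<open>Y\<close>; with \<open>i = 1\<close> the only row is \<open>Y\<close>. Calling the bottom
  row \<open>Y\<close> in both cases lets one calculation treat them together.\<close>

definition fill :: "nat \<Rightarrow> nat \<Rightarrow> (nat \<Rightarrow> int) \<Rightarrow> (nat \<Rightarrow> int) \<Rightarrow> nat \<Rightarrow> nat \<Rightarrow> nat" where
  "fill i m X Y = (\<lambda>r c. if 1 \<le> r \<and> r \<le> i \<and> 1 \<le> c \<and> c \<le> m
     then entry (if r = i then Y else X) c else 0)"

lemma cumulative_bounds:
  assumes "cumulative N m X"
  shows "0 \<le> X v" "X v \<le> int m"
proof -
  have m: "mono X" and "X 0 = 0" "X (max v N) = int m"
    using assms by (auto simp: cumulative_def)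
  then show "0 \<le> X v" "X v \<le> int m"
    using monoD[OF m, of 0 v] monoD[OF m, of v "max v N"] by auto
qed

text \<open>The Galois connection between a monotone count and its inverse; it turns statements
  about entries into inequalities between counts.\<close>

lemma entry_le_iff:
  assumes "cumulative N m X" "c \<le> m"
  shows "entry X c \<le> v \<longleftrightarrow> int c \<le> X v"
proof
  assume "entry X c \<le> v"
  moreover have "int c \<le> X (entry X c)"
    unfolding entry_def
    by (rule LeastI[of "\<lambda>v. int c \<le> X v" N]) (use assms in \<open>auto simp: cumulative_def\<close>)
  ultimately show "int c \<le> X v"
    using assms(1) by (auto simp: cumulative_def dest: monoD order_trans)
next
  assume "int c \<le> X v"
  then show "entry X c \<le> v"
    unfolding entry_def by (rule Least_le)
qed

lemma entry_eq_iff: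
  assumes "cumulative N m X" "c \<le> m" "1 \<le> j"
  shows "entry X c = j \<longleftrightarrow> X (j - 1) < int c \<and> int c \<le> X j"
  using entry_le_iff[OF assms(1,2), of j] entry_le_iff[OF assms(1,2), of "j - 1"] assms(3)
  by linarith

lemma cumulative_decrease:
  assumes "cumulative N m X" "1 \<le> j" "j < N" "X (j - 1) < X j"
  shows "cumulative N m (X(j := X j - 1))"
proof -
  have m: "mono X" using assms(1) by (simp add: cumulative_def)
  have "mono (X(j := X j - 1))"
  proof (rule monoI)
    fix a b :: nat assume "a \<le> b"
    moreover have "X a \<le> X j - 1" if "a \<le> j - 1"
      using monoD[OF m that] assms(4) by simp
    ultimately show "(X(j := X j - 1)) a \<le> (X(j := X j - 1)) b"
      using monoD[OF m \<open>a \<le> b\<close>] assms(2) by (cases "a = j"; cases "b = j") auto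
  qed
  then show ?thesis using assms by (auto simp: cumulative_def)
qed

text \<open>The letters \<open>j\<close> end in column \<open>X j\<close>, so lowering the count at
  \<open>j\<close> by one moves the boundary past exactly that column: the last \<open>j\<close>
  becomes \<open>j + 1\<close>.\<close>

lemma entry_decrease:
  assumes "cumulative N m X" "1 \<le> j" "j < N" "X (j - 1) < X j" "c \<le> m"
  shows "entry (X(j := X j - 1)) c = (if c = nat (X j) then j + 1 else entry X c)"
proof (rule antisym)
  note le = entry_le_iff[OF assms(1,5)]
    and le' = entry_le_iff[OF cumulative_decrease[OF assms(1-4)] assms(5)]
  have m: "mono X" using assms(1) by (simp add: cumulative_def)
  have "0 \<le> X j" using cumulative_bounds(1)[OF assms(1)] .
  then have c: "c = nat (X j) \<longleftrightarrow> int c = X j" by auto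
  have "X j \<le> X (j + 1)" by (auto intro: monoD[OF m])
  then show "entry (X(j := X j - 1)) c \<le> (if c = nat (X j) then j + 1 else entry X c)"
    unfolding le' using le[of "entry X c"] by (auto simp: c)
  define v where "v = entry (X(j := X j - 1)) c"
  have v: "int c \<le> (X(j := X j - 1)) v" using le'[of v] by (simp add: v_def)
  show "(if c = nat (X j) then j + 1 else entry X c) \<le> entry (X(j := X j - 1)) c"
    unfolding v_def[symmetric]
  proof (cases "c = nat (X j)")
    case True
    \<comment> \<open>The new count at \<open>j\<close> no longer reaches column \<open>X j\<close>,
      and by the strict inequality the counts before \<open>j\<close> do not either.\<close>
    then have "v \<noteq> j" "X v \<ge> X j" using v c by (auto split: if_splits)
    moreover have "X v \<le> X (j - 1)" if "v < j" using that by (intro monoD[OF m]) simp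
    ultimately have "j < v" using assms(4) by linarith
    then show "(if c = nat (X j) then j + 1 else entry X c) \<le> v" using True by simp
  next
    case False
    then show "(if c = nat (X j) then j + 1 else entry X c) \<le> v"
      using v le[of v] by (auto split: if_splits)
  qed
qed

lemma entry_eq_iff_mem:
  assumes "cumulative N m X" "1 \<le> j"
  shows "1 \<le> c \<and> c \<le> m \<and> entry X c = j \<longleftrightarrow> nat (X (j - 1)) < c \<and> c \<le> nat (X j)"
proof -
  have "0 \<le> X (j - 1)" "X j \<le> int m"
    using cumulative_bounds[OF assms(1)] by auto
  then show ?thesis
    using entry_eq_iff[OF assms(1) _ assms(2), of c] by linarith
qed

lemma filter_entry:
  assumes "cumulative N m X" "1 \<le> j"
  shows "filter (\<lambda>c. entry X c = j \<or> entry X c = j + 1) [1..<m + 1] =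
    [nat (X (j - 1)) + 1..<nat (X j) + 1] @ [nat (X j) + 1..<nat (X (j + 1)) + 1]"
proof -
  have m: "mono X" using assms(1) by (simp add: cumulative_def)
  have le: "nat (X (j - 1)) \<le> nat (X j)" "nat (X j) \<le> nat (X (j + 1))"
    by (rule nat_mono, rule monoD[OF m], simp)+
  note mem = entry_eq_iff_mem[OF assms]
    and mem' = entry_eq_iff_mem[OF assms(1), of "j + 1", unfolded add_diff_cancel_right', OF le_add2]
  have "filter (\<lambda>c. entry X c = j \<or> entry X c = j + 1) [1..<m + 1] =
    [nat (X (j - 1)) + 1..<nat (X (j + 1)) + 1]" (is "?l = ?r")
  \<comment> \<open>Both lists are strictly increasing, so comparing their sets suffices.\<close>
  proof (rule sorted_distinct_set_unique)
    show "sorted ?l" "sorted ?r"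
      by (simp_all add: sorted_wrt_filter del: upt_Suc)
    show "set ?l = set ?r"
    proof (intro set_eqI)
      fix c
      have "c \<in> set ?l \<longleftrightarrow> (1 \<le> c \<and> c \<le> m \<and> entry X c = j) \<or> (1 \<le> c \<and> c \<le> m \<and> entry X c = j + 1)"
        by (auto simp del: upt_Suc)
      also have "\<dots> \<longleftrightarrow> c \<in> set ?r"
        unfolding mem mem' set_upt atLeastLessThan_iff using le by linarith
      finally show "c \<in> set ?l \<longleftrightarrow> c \<in> set ?r" .
    qed
  qed simp_all
  also have "\<dots> = [nat (X (j - 1)) + 1..<nat (X j) + 1] @ [nat (X j) + 1..<nat (X (j + 1)) + 1]"
  proof -
    obtain k where k: "nat (X (j + 1)) + 1 = nat (X j) + 1 + k"
      using le(2) by (auto simp: le_iff_add)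
    show ?thesis unfolding k by (rule upt_add_eq_append) (use le(1) in simp)
  qed
  finally show ?thesis .
qed

lemma card_entry:
  assumes "cumulative N m X" "1 \<le> j"
  shows "int (card {c \<in> {1..m}. entry X c = j}) = X j - X (j - 1)"
proof -
  have "{c \<in> {1..m}. entry X c = j} = {nat (X (j - 1))<..nat (X j)}"
  proof (rule set_eqI)
    fix c
    show "c \<in> {c \<in> {1..m}. entry X c = j} \<longleftrightarrow> c \<in> {nat (X (j - 1))<..nat (X j)}"
      using entry_eq_iff_mem[OF assms, of c]
      unfolding mem_Collect_eq atLeastAtMost_iff greaterThanAtMost_iff conj_assoc .
  qed
  moreover have "X (j - 1) \<le> X j"
    using assms(1) by (auto simp: cumulative_def intro: monoD)
  ultimately show ?thesis
    using cumulative_bounds(1)[OF assms(1), of "j - 1"] by simp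
qed

section \<open>The bracketing rule on at most two rows\<close>

lemma unpaired_four_blocks:
  assumes "\<forall>x\<in>set as. w x = j" "\<forall>x\<in>set bs. w x = j + 1"
    "\<forall>x\<in>set cs. w x = j" "\<forall>x\<in>set ds. w x = j + 1"
  shows "unpaired w j (as @ bs @ cs @ ds) =
    as @ take (length bs - length cs) bs @ drop (length bs) cs @ ds"
proof -
  have 1: "unpaired w j ds = ds"
    using assms(4) by (induction ds) (auto split: list.splits)
  have 2: "unpaired w j (cs @ ds) = cs @ ds"
    using assms(3) by (induction cs) (auto simp: 1 split: list.splits)
  \<comment> \<open>Only letters of \<open>bs\<close> precede letters they can cancel, those of
    \<open>cs\<close>. The cancellation starts where the two blocks meet, so what survives is a
    beginning of \<open>bs\<close> or an end of \<open>cs\<close>.\<close>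
  have 3: "unpaired w j (bs @ cs @ ds) = take (length bs - length cs) bs @ drop (length bs) cs @ ds"
    using assms(2)
  proof (induction bs)
    case Nil
    then show ?case by (simp add: 2)
  next
    case (Cons b bs)
    show ?case
    proof (cases "length bs < length cs")
      \<comment> \<open>A letter of \<open>cs\<close> heads the survivors of the tail, so
        \<open>b\<close> cancels against it.\<close>
      case True
      then have "drop (length bs) cs = cs ! length bs # drop (Suc (length bs)) cs"
        by (simp add: Cons_nth_drop_Suc)
      then show ?thesis using True Cons assms(3) by simp
    next
      case False
      \<comment> \<open>All of \<open>cs\<close> is used up and only letters \<open>j + 1\<close>
        are left, so \<open>b\<close> survives.\<close>
      define R where "R = take (length bs - length cs) bs @ ds"
      have "\<forall>x\<in>set R. w x = j + 1"
        using Cons.prems assms(4) by (auto simp: R_def dest: in_set_takeD)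
      moreover have "unpaired w j (bs @ cs @ ds) = R"
        using False Cons by (simp add: R_def)
      ultimately have "unpaired w j ((b # bs) @ cs @ ds) = b # R"
        by (auto split: list.splits)
      then show ?thesis using False by (simp add: R_def Suc_diff_le)
    qed
  qed
  show ?thesis
    using assms(1) by (induction as) (auto simp: 3 split: list.splits)
qed

text \<open>The lower row is read first, so its letters \<open>j + 1\<close> cancel letters
  \<open>j\<close> of the upper row. If a \<open>j\<close> of the upper row survives, the last one
  is the rightmost unpaired \<open>j\<close>; otherwise it is the last \<open>j\<close> of the lower
  row. For \<open>i = 1\<close>, \<open>X1\<close> makes the missing upper row contribute an empty
  block.\<close>

lemma tab_f_fill:
  assumes i: "i \<in> {1, 2}" and Y: "cumulative N m Y" and X: "i = 2 \<Longrightarrow> cumulative N m X"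
    and X1: "i = 1 \<Longrightarrow> X j = X (j - 1)" and j: "1 \<le> j" "j < N"
  shows "tab_f i m j (fill i m X Y) =
    (if Y (j + 1) - Y j < X j - X (j - 1) then Some (fill i m (X(j := X j - 1)) Y)
     else if Y (j - 1) < Y j then Some (fill i m X (Y(j := Y j - 1)))
     else None)"
proof -
  define T where "T = fill i m X Y"
  define w where "w = (\<lambda>(r, c). T r c)"
  define as where "as = map (Pair i) [nat (Y (j - 1)) + 1..<nat (Y j) + 1]"
  define bs where "bs = map (Pair i) [nat (Y j) + 1..<nat (Y (j + 1)) + 1]"
  define cs where "cs = (if i = 2 then map (Pair (1::nat)) [nat (X (j - 1)) + 1..<nat (X j) + 1] else [])"
  define ds where "ds = (if i = 2 then map (Pair (1::nat)) [nat (X j) + 1..<nat (X (j + 1)) + 1] else [])"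
  define P where "P = (\<lambda>x. w x = j \<or> w x = j + 1)"
  have row: "filter P (map (Pair r) [1..<m + 1]) =
      map (Pair r) (filter (\<lambda>c. entry (if r = i then Y else X) c = j
        \<or> entry (if r = i then Y else X) c = j + 1) [1..<m + 1])" if "1 \<le> r" "r \<le> i" for r
    unfolding filter_map o_def P_def w_def T_def fill_def
    by (rule arg_cong[where f = "map (Pair r)"], rule filter_cong) (use that in auto)
  have read: "filter P (reading_cells i m) = as @ bs @ cs @ ds"
  proof (cases "i = 1")
    case True
    then show ?thesis
      using row[of 1] filter_entry[OF Y j(1)]
      by (simp add: reading_cells_def as_def bs_def cs_def ds_def)
  next
    case False
    then have [simp]: "i = 2" using i by simp
    have "rev [Suc 0..<Suc 2] = [2, 1]" by (simp add: upt_rec)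
    then show ?thesis
      using row[of 1] row[of 2] filter_entry[OF Y j(1)] filter_entry[OF X j(1)]
      by (simp add: reading_cells_def as_def bs_def cs_def ds_def)
  qed
  have mY: "mono Y" using Y by (simp add: cumulative_def)
  have leY: "Y (j - 1) \<le> Y j" "Y j \<le> Y (j + 1)" by (auto intro: monoD[OF mY])
  have leX: "X (j - 1) \<le> X j \<and> X j \<le> X (j + 1)" if "i = 2"
    using X[OF that] by (auto simp: cumulative_def intro: monoD)
  note bY = cumulative_bounds[OF Y] and bX = cumulative_bounds[OF X]
  have wY: "w (i, c) = v" if "nat (Y (v - 1)) < c \<and> c \<le> nat (Y v)" "1 \<le> v" for c v
  proof -
    have "1 \<le> c \<and> c \<le> m \<and> entry Y c = v"
      using entry_eq_iff_mem[OF Y that(2)] that(1) by blast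
    then show ?thesis using i by (auto simp: w_def T_def fill_def)
  qed
  have wX: "w (1, c) = v" if "nat (X (v - 1)) < c \<and> c \<le> nat (X v)" "1 \<le> v" "i = 2" for c v
  proof -
    have "1 \<le> c \<and> c \<le> m \<and> entry X c = v"
      using entry_eq_iff_mem[OF X[OF that(3)] that(2)] that(1) by blast
    then show ?thesis using that(3) by (auto simp: w_def T_def fill_def)
  qed
  have as: "\<forall>x\<in>set as. w x = j" and bs: "\<forall>x\<in>set bs. w x = j + 1"
    using j(1) wY[of j] wY[of "j + 1"] by (auto simp: as_def bs_def simp del: upt_Suc)
  have cs: "\<forall>x\<in>set cs. w x = j" and ds: "\<forall>x\<in>set ds. w x = j + 1"
    using j(1) wX[of j] wX[of "j + 1"] by (auto simp: cs_def ds_def simp del: upt_Suc)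
  have unp: "unpaired_cells i m j T = as @ take (length bs - length cs) bs @ drop (length bs) cs @ ds"
    using read unpaired_four_blocks[OF as bs cs ds]
    by (simp add: unpaired_cells_def P_def w_def)
  have id: "filter (\<lambda>(r, c). T r c = j) zs = zs" if "\<forall>x\<in>set zs. w x = j" for zs
    using that by (auto simp: w_def filter_id_conv)
  have empty: "filter (\<lambda>(r, c). T r c = j) zs = []" if "\<forall>x\<in>set zs. w x = j + 1" for zs
    using that by (auto simp: w_def filter_empty_conv)
  have "\<forall>x\<in>set (take (length bs - length cs) bs). w x = j + 1"
    using bs by (blast dest: in_set_takeD)
  moreover have "\<forall>x\<in>set (drop (length bs) cs). w x = j"
    using cs by (blast dest: in_set_dropD)
  ultimately have f: "filter (\<lambda>(r, c). T r c = j) (unpaired_cells i m j T) = as @ drop (length bs) cs"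
    by (simp only: unp filter_append id[OF as] empty[OF ds] id empty append_Nil append_Nil2)
  have len: "int (length as) = Y j - Y (j - 1)" "int (length bs) = Y (j + 1) - Y j"
    "int (length cs) = X j - X (j - 1)"
    using leY leX X1 i bY[of "j - 1"] bY[of j] bX(1)[of "j - 1"]
    by (auto simp: as_def bs_def cs_def simp del: upt_Suc)
  consider (upper) "Y (j + 1) - Y j < X j - X (j - 1)"
    | (lower) "\<not> Y (j + 1) - Y j < X j - X (j - 1)" "Y (j - 1) < Y j"
    | (none) "\<not> Y (j + 1) - Y j < X j - X (j - 1)" "Y (j - 1) = Y j"
    using leY by linarith
  then show ?thesis
  proof cases
    case upper
    then have [simp]: "i = 2" and less: "X (j - 1) < X j"
      using i leY X1 by auto
    have in_row: "1 \<le> nat (X j)" "nat (X j) \<le> m"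
      using less bX(1)[OF \<open>i = 2\<close>, of "j - 1"] bX(2)[OF \<open>i = 2\<close>, of j] by linarith+
    have "length bs < length cs" using upper len by linarith
    moreover have "last cs = (1, nat (X j))"
    proof -
      have "nat (X (j - 1)) < nat (X j)" using less bX(1)[OF \<open>i = 2\<close>, of "j - 1"] by linarith
      then show ?thesis by (simp add: cs_def last_map Suc_le_eq del: zless_nat_conj)
    qed
    ultimately have "tab_f i m j T = Some (upd T 1 (nat (X j)) (j + 1))"
      unfolding tab_f_def Let_def f by (simp add: last_drop)
    also have "upd T 1 (nat (X j)) (j + 1) = fill i m (X(j := X j - 1)) Y"
    proof (intro ext)
      fix r c
      show "upd T 1 (nat (X j)) (j + 1) r c = fill i m (X(j := X j - 1)) Y r c"
        using in_row entry_decrease[OF X j less, of c]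
        by (cases "r = 1"; cases "c = nat (X j)") (auto simp: T_def fill_def upd_def)
    qed
    finally show ?thesis using upper by (simp add: T_def)
  next
    case lower
    have in_row: "1 \<le> nat (Y j)" "nat (Y j) \<le> m"
      using lower(2) bY(1)[of "j - 1"] bY(2)[of j] by linarith+
    have "length cs \<le> length bs" using lower len by linarith
    moreover have "as \<noteq> []" using lower len(1) by (metis diff_gt_0_iff_gt less_irrefl list.size(3) of_nat_0)
    moreover have "last as = (i, nat (Y j))"
    proof -
      have "nat (Y (j - 1)) < nat (Y j)" using lower(2) bY(1)[of "j - 1"] by linarith
      then show ?thesis by (simp add: as_def last_map Suc_le_eq del: zless_nat_conj)
    qed
    ultimately have "tab_f i m j T = Some (upd T i (nat (Y j)) (j + 1))"
      unfolding tab_f_def Let_def f by simp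
    also have "upd T i (nat (Y j)) (j + 1) = fill i m X (Y(j := Y j - 1))"
    proof (intro ext)
      fix r c
      show "upd T i (nat (Y j)) (j + 1) r c = fill i m X (Y(j := Y j - 1)) r c"
        using i in_row entry_decrease[OF Y j lower(2), of c]
        by (cases "r = i"; cases "c = nat (Y j)") (auto simp: T_def fill_def upd_def)
    qed
    finally show ?thesis using lower by (simp add: T_def)
  next
    case none
    have "length cs \<le> length bs" using none len by linarith
    moreover have "as = []" using none(2) len(1) by simp
    ultimately have "tab_f i m j T = None"
      unfolding tab_f_def Let_def f by simp
    then show ?thesis using none by (simp add: T_def)
  qed
qed

section \<open>Powers of \<open>f_j\<close> on encoded tableaux\<close>

lemma f_pow_0 [simp]: "f_pow i m j 0 x = x"
  by (simp add: f_pow_def)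

lemma f_pow_Suc: "f_pow i m j (Suc c) x = Option.bind (f_pow i m j c x) (tab_f i m j)"
  by (simp add: f_pow_def)

lemma f_pow_add: "f_pow i m j (a + b) x = f_pow i m j b (f_pow i m j a x)"
  by (induction b) (simp_all add: f_pow_Suc)

lemma fill_1: "fill 1 m X Y = fill 1 m X' Y"
  by (auto simp: fill_def fun_eq_iff)

text \<open>Each step shrinks the surplus of letters \<open>j\<close> in the upper row by one, so up
  to the initial surplus the first case of \<open>tab_f_fill\<close> applies every time. A positive
  surplus forces \<open>i = 2\<close>.\<close>

lemma f_pow_fill_upper:
  assumes i: "i \<in> {1, 2}" and Y: "cumulative N m Y" and X: "i = 2 \<Longrightarrow> cumulative N m X"
    and X1: "i = 1 \<Longrightarrow> X j = X (j - 1)" and j: "1 \<le> j" "j < N"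
    and p: "int p \<le> X j - X (j - 1) - (Y (j + 1) - Y j)"
  shows "f_pow i m j p (Some (fill i m X Y)) = Some (fill i m (X(j := X j - int p)) Y) \<and>
    (i = 2 \<longrightarrow> cumulative N m (X(j := X j - int p)))"
  using p
proof (induction p)
  case 0
  then show ?case using X by simp
next
  case (Suc p)
  have Ym: "Y j \<le> Y (j + 1)" using Y by (auto simp: cumulative_def intro: monoD)
  have i2: "i = 2" using Suc.prems Ym X1 i by auto
  define X' where "X' = X(j := X j - int p)"
  have "int p \<le> X j - X (j - 1) - (Y (j + 1) - Y j)" using Suc.prems by simp
  then have IH: "f_pow i m j p (Some (fill i m X Y)) = Some (fill i m X' Y)" "cumulative N m X'"
    unfolding X'_def using Suc.IH i2 by blast+
  have X'j: "X' j = X j - int p" "X' (j - 1) = X (j - 1)"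
    using j by (auto simp: X'_def)
  have "Y (j + 1) - Y j < X' j - X' (j - 1)" "X' (j - 1) < X' j"
    unfolding X'j using Suc.prems Ym by linarith+
  moreover have "X'(j := X' j - 1) = X(j := X j - int (Suc p))"
    by (simp add: X'_def algebra_simps)
  ultimately show ?case
    using IH tab_f_fill[OF i Y IH(2) _ j] cumulative_decrease[OF IH(2) j] i2
    by (simp add: f_pow_Suc del: fun_upd_apply)
qed

text \<open>Lowering \<open>Y j\<close> enlarges the block of letters \<open>j + 1\<close> in the
  lower row, so an upper row without surplus never regains one.\<close>

lemma f_pow_fill_lower:
  assumes i: "i \<in> {1, 2}" and Y: "cumulative N m Y" and X: "i = 2 \<Longrightarrow> cumulative N m X"
    and X1: "i = 1 \<Longrightarrow> X j = X (j - 1)" and j: "1 \<le> j" "j < N"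
    and le: "X j - X (j - 1) \<le> Y (j + 1) - Y j" and q: "int q \<le> Y j - Y (j - 1)"
  shows "f_pow i m j q (Some (fill i m X Y)) = Some (fill i m X (Y(j := Y j - int q))) \<and>
    cumulative N m (Y(j := Y j - int q))"
  using q
proof (induction q)
  case 0
  then show ?case using Y by simp
next
  case (Suc q)
  define Y' where "Y' = Y(j := Y j - int q)"
  have "int q \<le> Y j - Y (j - 1)" using Suc.prems by simp
  then have IH: "f_pow i m j q (Some (fill i m X Y)) = Some (fill i m X Y')" "cumulative N m Y'"
    unfolding Y'_def using Suc.IH by blast+
  have Y'j: "Y' j = Y j - int q" "Y' (j - 1) = Y (j - 1)" "Y' (j + 1) = Y (j + 1)"
    using j by (auto simp: Y'_def)
  have "\<not> Y' (j + 1) - Y' j < X j - X (j - 1)" "Y' (j - 1) < Y' j"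
    unfolding Y'j using Suc.prems le by linarith+
  moreover have "Y'(j := Y' j - 1) = Y(j := Y j - int (Suc q))"
    by (simp add: Y'_def algebra_simps)
  ultimately show ?case
    using IH tab_f_fill[OF i IH(2) X X1 j] cumulative_decrease[OF IH(2) j]
    by (simp add: f_pow_Suc del: fun_upd_apply)
qed

text \<open>A power of \<open>f_j\<close> first uses up the surplus of the upper row and only then
  continues in the lower row; \<open>pq\<close> records this order.\<close>

lemma f_pow_fill:
  assumes i: "i \<in> {1, 2}" and Y: "cumulative N m Y" and X: "i = 2 \<Longrightarrow> cumulative N m X"
    and X1: "i = 1 \<Longrightarrow> X j = X (j - 1)" and j: "1 \<le> j" "j < N"
    and c: "int c = p + q" and p: "0 \<le> p" "p \<le> X j - X (j - 1) - (Y (j + 1) - Y j)"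
    and q: "0 \<le> q" "q \<le> Y j - Y (j - 1)"
    and pq: "q = 0 \<or> p = X j - X (j - 1) - (Y (j + 1) - Y j)"
  shows "f_pow i m j c (Some (fill i m X Y)) =
    Some (fill i m (X(j := X j - p)) (Y(j := Y j - q)))"
proof -
  define X' where "X' = X(j := X j - p)"
  have "f_pow i m j c x = f_pow i m j (nat q) (f_pow i m j (nat p) x)" for x
  proof -
    have "c = nat p + nat q" using c p q by linarith
    then show ?thesis by (simp add: f_pow_add)
  qed
  moreover have "f_pow i m j (nat p) (Some (fill i m X Y)) = Some (fill i m X' Y)"
    and X': "i = 2 \<Longrightarrow> cumulative N m X'"
    using f_pow_fill_upper[OF i Y X X1 j, of "nat p"] p by (auto simp: X'_def)
  moreover have "f_pow i m j (nat q) (Some (fill i m X' Y)) = Some (fill i m X' (Y(j := Y j - q)))"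
  proof (cases "q = 0")
    case False
    have X'_simps: "X' j = X j - p" "X' (j - 1) = X (j - 1)"
      using j by (auto simp: X'_def)
    have X'j: "X' j - X' (j - 1) = Y (j + 1) - Y j"
      using False pq unfolding X'_simps by linarith
    have Ym: "Y j \<le> Y (j + 1)" using Y by (auto simp: cumulative_def intro: monoD)
    \<comment> \<open>For \<open>i = 1\<close> the bounds on \<open>p\<close> leave only
      \<open>p = 0\<close>.\<close>
    have X1': "X' j = X' (j - 1)" if "i = 1"
      using X1[OF that] p Ym unfolding X'_simps by linarith
    show ?thesis
      using f_pow_fill_lower[OF i Y X' X1' j, of "nat q"] X'j q
      by (simp del: fun_upd_apply)
  qed simp
  ultimately show ?thesis by (simp add: X'_def)
qed

section \<open>Composites of the operators as chains of states\<close>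

lemma fold_upt_chain:
  assumes "i \<le> l" "\<And>j. i \<le> j \<Longrightarrow> j < l \<Longrightarrow> h (j + 1) (st j) = st (j + 1)"
  shows "fold h [i + 1..<l + 1] (st i) = st l"
  using assms
proof (induction l)
  case (Suc l)
  then show ?case by (cases "i = Suc l") auto
qed simp

text \<open>\<open>st l i\<close> is the result after \<open>D_l\<close>, and \<open>st l j\<close>
  for larger \<open>j\<close> the result after the power of \<open>f_j\<close> inside
  \<open>X_l\<close>; at \<open>n + 1\<close> only \<open>G\<close> has acted. \<open>st\<close> is
  arbitrary because there are two uses: explicit tableaux, and images of arrays under an
  isomorphism.\<close>

lemma tab_T_eq:
  assumes "i \<le> 2"
    and G: "op_G n i m A (Some (highest_tab i m)) = st (n + 1) (n + 1)"
    and D: "\<And>l. 2 \<le> l \<Longrightarrow> l \<le> n \<Longrightarrow> op_D i m A l (st (l + 1) (l + 1)) = st l i"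
    and f: "\<And>l j. 2 \<le> l \<Longrightarrow> l \<le> n \<Longrightarrow> i \<le> j \<Longrightarrow> j < l \<Longrightarrow>
      f_pow i m (j + 1) (\<Sum>p = 1..i. A p l) (st l j) = st l (j + 1)"
    and k: "2 \<le> k" "k \<le> n + 1"
  shows "tab_T n i m A k = st k k"
  using k(2)
proof (induction k rule: inc_induct)
  case base
  show ?case using G by (simp add: tab_T_def)
next
  case (step l)
  have l: "2 \<le> l" "l \<le> n" using step k by auto
  have "tab_T n i m A l = op_X i m A l (tab_T n i m A (l + 1))"
    using step(2) by (simp add: tab_T_def upt_conv_Cons del: upt_Suc)
  also have "\<dots> = fold (\<lambda>j. f_pow i m j (\<Sum>p = 1..i. A p l)) [i + 1..<l + 1] (st l i)"
    using step D[OF l] by (simp add: op_X_def del: upt_Suc)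
  also have "\<dots> = st l l"
    by (rule fold_upt_chain) (use l f assms(1) in auto)
  finally show ?case .
qed

lemma entry_step:
  assumes "1 \<le> k" "1 \<le> c" "c \<le> m"
  shows "entry (\<lambda>v. if v < k then 0 else int m) c = k"
proof -
  have "cumulative k m (\<lambda>v. if v < k then 0 else int m)"
    using assms by (auto simp: cumulative_def mono_def)
  from entry_eq_iff[OF this assms(3,1)] show ?thesis using assms by simp
qed

lemma highest_tab_eq_fill:
  assumes "i \<in> {1, 2}"
  shows "highest_tab i m = fill i m (\<lambda>v. if v < i - 1 then 0 else int m) (\<lambda>v. if v < i then 0 else int m)"
proof (intro ext)
  fix r c
  show "highest_tab i m r c =
    fill i m (\<lambda>v. if v < i - 1 then 0 else int m) (\<lambda>v. if v < i then 0 else int m) r c"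
    using assms entry_step[of i c m] entry_step[of "i - 1" c m]
    by (cases "r = i") (auto simp: highest_tab_def fill_def)
qed

section \<open>Dyck paths with at most two columns\<close>

lemma dyck_path_fst_mono:
  assumes "dyck_path n i \<beta>" "1 \<le> r" "r \<le> r'" "r' \<le> n"
  shows "fst (\<beta> r) \<le> fst (\<beta> r')"
  using assms(3,4)
proof (induction r' rule: dec_induct)
  case (step r')
  then have "r' \<in> {1..<n}" using assms(2) by auto
  then have "fst (\<beta> r') \<le> fst (\<beta> (r' + 1))"
    using assms(1) unfolding dyck_path_def by (metis fst_conv le_add1 order_refl)
  then show ?case using step by simp
qed simp

lemma dyck_path_sum:
  assumes "dyck_path n i \<beta>" "1 \<le> r" "r \<le> n"
  shows "fst (\<beta> r) + snd (\<beta> r) = i + r"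
  using assms(2,3)
proof (induction r rule: dec_induct)
  case base
  then show ?case using assms(1) by (simp add: dyck_path_def)
next
  case (step r)
  then have "r \<in> {1..<n}" by auto
  then have "\<beta> (r + 1) = (fst (\<beta> r), snd (\<beta> r) + 1) \<or> \<beta> (r + 1) = (fst (\<beta> r) + 1, snd (\<beta> r))"
    using assms(1) unfolding dyck_path_def by blast
  then show ?case using step by auto
qed

text \<open>For \<open>i \<le> 2\<close> a Dyck path is determined by the row \<open>s\<close> in which it leaves the first column.\<close>

lemma kr_arrays_iff:
  assumes i: "i \<in> {1, 2}" and n: "2 \<le> n"
  shows "A \<in> kr_arrays n i m \<longleftrightarrow>
    (\<forall>p q. \<not> (1 \<le> p \<and> p \<le> i \<and> i \<le> q \<and> q \<le> n) \<longrightarrow> A p q = 0) \<and>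
    (\<forall>s\<in>{i..n}. (\<Sum>j = i..s. A 1 j) + (\<Sum>j = s..n. A 2 j) \<le> m)"
    (is "_ \<longleftrightarrow> ?supp \<and> ?sums")
proof (cases ?supp)
  case supp: True
  have "(\<forall>\<beta>. dyck_path n i \<beta> \<longrightarrow> (\<Sum>r = 1..n. A (fst (\<beta> r)) (snd (\<beta> r))) \<le> m) \<longleftrightarrow> ?sums"
  proof (cases "i = 1")
    case True
    have A2: "A 2 j = 0" for j using supp True by simp
    \<comment> \<open>With \<open>i = 1\<close> every path stays in the first column, and the
      inequality for \<open>s = n\<close> implies the others.\<close>
    have sum: "(\<Sum>r = 1..n. A (fst (\<beta> r)) (snd (\<beta> r))) = (\<Sum>j = i..n. A 1 j)"
      if "dyck_path n i \<beta>" for \<beta>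
    proof (rule sum.cong)
      fix r assume "r \<in> {i..n}"
      then have r: "1 \<le> r" "r \<le> n" using True by auto
      have "fst (\<beta> 1) = 1" "fst (\<beta> n) = 1"
        using that True by (auto simp: dyck_path_def)
      then have "fst (\<beta> r) = 1"
        using dyck_path_fst_mono[OF that, of 1 r] dyck_path_fst_mono[OF that, of r n] r by simp
      then show "A (fst (\<beta> r)) (snd (\<beta> r)) = A 1 r"
        using dyck_path_sum[OF that r] True by simp
    qed (simp add: True)
    have "dyck_path n i (\<lambda>r. (1, r))" using True by (auto simp: dyck_path_def)
    then have "(\<forall>\<beta>. dyck_path n i \<beta> \<longrightarrow> (\<Sum>r = 1..n. A (fst (\<beta> r)) (snd (\<beta> r))) \<le> m) \<longleftrightarrow>
        (\<Sum>j = i..n. A 1 j) \<le> m"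
      using sum by auto
    also have "\<dots> \<longleftrightarrow> ?sums"
    proof
      assume le: "(\<Sum>j = i..n. A 1 j) \<le> m"
      show ?sums
      proof
        fix s assume "s \<in> {i..n}"
        then have "(\<Sum>j = i..s. A 1 j) \<le> (\<Sum>j = i..n. A 1 j)"
          by (intro sum_mono2) auto
        then show "(\<Sum>j = i..s. A 1 j) + (\<Sum>j = s..n. A 2 j) \<le> m" using le by (simp add: A2)
      qed
    next
      assume ?sums
      then show "(\<Sum>j = i..n. A 1 j) \<le> m" using True n by (force simp: A2)
    qed
    finally show ?thesis .
  next
    case False
    then have i2 [simp]: "i = 2" using i by simp
    \<comment> \<open>Column plus row is \<open>r + 2\<close> at position \<open>r\<close>. Hence
      the path leaving column 1 in row \<open>s\<close> is at \<open>(1, s)\<close> in position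
      \<open>s - 1\<close> and at \<open>(2, s)\<close> in position \<open>s\<close>.\<close>
    define path where "path = (\<lambda>s r. if r < s then (1::nat, r + 1 :: nat) else (2, r))"
    have path_sum: "(\<Sum>r = 1..n. A (fst (path s r)) (snd (path s r))) =
        (\<Sum>j = i..s. A 1 j) + (\<Sum>j = s..n. A 2 j)" if "s \<in> {i..n}" for s
    proof -
      have "{1..n} = {1..<s} \<union> {s..n}" using that by auto
      then have "(\<Sum>r = 1..n. A (fst (path s r)) (snd (path s r))) =
        (\<Sum>r = 1..<s. A (fst (path s r)) (snd (path s r))) + (\<Sum>r = s..n. A (fst (path s r)) (snd (path s r)))"
        by (simp add: sum.union_disjoint ivl_disj_int)
      also have "(\<Sum>r = 1..<s. A (fst (path s r)) (snd (path s r))) = (\<Sum>r = 1..<s. A 1 (Suc r))"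
        by (rule sum.cong) (auto simp: path_def)
      also have "\<dots> = (\<Sum>j = i..s. A 1 j)"
        by (simp add: sum.shift_bounds_Suc_ivl[symmetric] atLeastLessThanSuc_atLeastAtMost numeral_2_eq_2)
      also have "(\<Sum>r = s..n. A (fst (path s r)) (snd (path s r))) = (\<Sum>j = s..n. A 2 j)"
        by (rule sum.cong) (auto simp: path_def)
      finally show ?thesis .
    qed
    have dyck: "dyck_path n i (path s)" if "s \<in> {i..n}" for s
      using that by (auto simp: dyck_path_def path_def)
    have ex: "\<exists>s\<in>{i..n}. \<forall>r\<in>{1..n}. \<beta> r = path s r" if b: "dyck_path n i \<beta>" for \<beta>
    proof -
      have ends: "\<beta> 1 = (1, 2)" "\<beta> n = (2, n)" using b by (auto simp: dyck_path_def)
      \<comment> \<open>The first position in column 2; since column plus row is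
        \<open>s + 2\<close> there, it is also the row of the crossing.\<close>
      define s where "s = (LEAST r. 1 \<le> r \<and> fst (\<beta> r) = 2)"
      have s: "1 \<le> s" "fst (\<beta> s) = 2"
        using LeastI[of "\<lambda>r. 1 \<le> r \<and> fst (\<beta> r) = 2" n] ends n by (auto simp: s_def)
      have "s \<le> n" unfolding s_def by (rule Least_le) (use ends n in auto)
      moreover have "s \<noteq> 1" using s ends by auto
      moreover have "\<beta> r = path s r" if "r \<in> {1..n}" for r
      proof -
        have r: "1 \<le> r" "r \<le> n" using that by auto
        have bounds: "1 \<le> fst (\<beta> r)" "fst (\<beta> r) \<le> 2"
          using dyck_path_fst_mono[OF b, of 1 r] dyck_path_fst_mono[OF b, of r n] r ends by auto
        have "fst (\<beta> r) = (if r < s then 1 else 2)"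
        proof (cases "r < s")
          case True
          then have "fst (\<beta> r) \<noteq> 2" using not_less_Least[of r] r unfolding s_def by blast
          then show ?thesis using True bounds by auto
        next
          case False
          then show ?thesis using dyck_path_fst_mono[OF b s(1), of r] s(2) r bounds by simp
        qed
        then show ?thesis
          using dyck_path_sum[OF b r] by (auto simp: path_def prod_eq_iff split: if_splits)
      qed
      ultimately show ?thesis using s(1) by (intro bexI[of _ s]) auto
    qed
    show ?thesis
    proof
      assume "\<forall>\<beta>. dyck_path n i \<beta> \<longrightarrow> (\<Sum>r = 1..n. A (fst (\<beta> r)) (snd (\<beta> r))) \<le> m"
      then show ?sums using dyck path_sum by metis
    next
      assume sums: ?sums
      show "\<forall>\<beta>. dyck_path n i \<beta> \<longrightarrow> (\<Sum>r = 1..n. A (fst (\<beta> r)) (snd (\<beta> r))) \<le> m"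
      proof (intro allI impI)
        fix \<beta> assume "dyck_path n i \<beta>"
        then obtain s where s: "s \<in> {i..n}" "\<forall>r\<in>{1..n}. \<beta> r = path s r" using ex by blast
        then have "(\<Sum>r = 1..n. A (fst (\<beta> r)) (snd (\<beta> r))) = (\<Sum>r = 1..n. A (fst (path s r)) (snd (path s r)))"
          by (intro sum.cong) auto
        then show "(\<Sum>r = 1..n. A (fst (\<beta> r)) (snd (\<beta> r))) \<le> m"
          using sums path_sum s(1) by simp
      qed
    qed
  qed
  then show ?thesis using supp by (simp add: kr_arrays_def)
next
  case False
  then show ?thesis unfolding kr_arrays_def by blast
qed

section \<open>The tableaux determined by an array\<close>

locale kr_array =
  fixes n i m :: nat and A :: "nat \<Rightarrow> nat \<Rightarrow> nat"
  assumes n: "2 \<le> n" and i: "i \<in> {1, 2}" and A: "A \<in> kr_arrays n i m"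
begin

definition pos :: "nat \<Rightarrow> int" where "pos k = max 0 (\<Sigma>_seq n A k)"
definition neg :: "nat \<Rightarrow> int" where "neg k = min 0 (\<Sigma>_seq n A k)"
definition neg_sum :: "nat \<Rightarrow> int" where "neg_sum k = (\<Sum>j = k..n. neg j)"
definition psum :: "nat \<Rightarrow> int" where "psum k = (\<Sum>j = i..k. int (A 1 j))"
definition C :: int where "C = int m - psum n"
definition F :: "nat \<Rightarrow> int" where "F v = C + psum v + pos v"
definition L :: "nat \<Rightarrow> int" where "L v = C + neg_sum v + psum (v - 1)"

section \<open>The numbers \<open>\<Sigma>_seq\<close> and the Dyck path inequalities\<close>

lemma support: "\<not> (1 \<le> p \<and> p \<le> i \<and> i \<le> q \<and> q \<le> n) \<Longrightarrow> A p q = 0"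
  using A by (auto simp: kr_arrays_def)

lemma i_bounds: "1 \<le> i" "i \<le> 2"
  using i by auto

lemma path_le:
  assumes "i \<le> s" "s \<le> n"
  shows "(\<Sum>j = i..s. int (A 1 j)) + (\<Sum>j = s..n. int (A 2 j)) \<le> int m"
proof -
  have "(\<Sum>j = i..s. A 1 j) + (\<Sum>j = s..n. A 2 j) \<le> m"
    using A kr_arrays_iff[OF i n] assms by auto
  then have "int ((\<Sum>j = i..s. A 1 j) + (\<Sum>j = s..n. A 2 j)) \<le> int m"
    by (simp only: of_nat_le_iff)
  then show ?thesis by simp
qed

lemma chi_eq: "\<chi>_seq n A k = (if \<Sigma>_seq n A k < 0 \<or> n \<le> k then 1 else 0)"
  by (simp add: \<chi>_seq.simps)

lemma Sigma_ge: "n \<le> k \<Longrightarrow> \<Sigma>_seq n A k = - int (A 2 n)"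
  by (simp add: \<Sigma>_seq.simps)

text \<open>The value \<open>1\<close> of \<open>\<chi>_seq\<close> from \<open>n\<close> on fits,
  because \<open>\<Sigma>_seq\<close> equals \<open>- int (A 2 n)\<close> there and so is never
  positive.\<close>

lemma chi_neg: "\<chi>_seq n A k * \<Sigma>_seq n A k = neg k"
  using Sigma_ge[of k] by (auto simp: chi_eq neg_def)

lemma chi_pos: "(1 - \<chi>_seq n A k) * \<Sigma>_seq n A k = pos k"
  using Sigma_ge[of k] by (auto simp: chi_eq pos_def)

lemma pos_ge: "n \<le> k \<Longrightarrow> pos k = 0"
  by (simp add: pos_def Sigma_ge)

text \<open>At \<open>k = n\<close> the recursion persists because \<open>A 1 (n + 1)\<close> and
  \<open>pos (n + 1)\<close> vanish; this absorbs the special starting value.\<close>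

lemma Sigma_rec:
  assumes "k \<le> n"
  shows "\<Sigma>_seq n A k = int (A 1 (k + 1)) + pos (k + 1) - int (A 2 k)"
proof (cases "k = n")
  case True
  then show ?thesis using support[of 1 "n + 1"] by (simp add: Sigma_ge pos_ge)
next
  case False
  then show ?thesis
    using assms \<Sigma>_seq.simps[of n A k] chi_pos[of "k + 1"] by simp
qed

lemma pos_neg: "pos k + neg k = \<Sigma>_seq n A k" "0 \<le> pos k" "neg k \<le> 0"
  "neg k = 0 \<or> pos k = 0"
  by (auto simp: pos_def neg_def)

lemma psum_Suc: "i \<le> k + 1 \<Longrightarrow> psum (k + 1) = psum k + int (A 1 (k + 1))"
  by (simp add: psum_def)

lemma psum_minus: "i \<le> k \<Longrightarrow> psum k = psum (k - 1) + int (A 1 k)"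
  using psum_Suc[of "k - 1"] i by (cases k) auto

lemma psum_nonneg: "0 \<le> psum k"
  by (simp add: psum_def sum_nonneg)

lemma neg_sum_step: "k \<le> n \<Longrightarrow> neg_sum k = neg k + neg_sum (k + 1)"
  by (simp add: neg_sum_def sum.atLeast_Suc_atMost)

lemma neg_sum_gt: "n < k \<Longrightarrow> neg_sum k = 0"
  by (simp add: neg_sum_def)

lemma neg_sum_le: "neg_sum k \<le> 0"
  unfolding neg_sum_def by (rule sum_nonpos) (simp add: pos_neg)

text \<open>By the recursion \<open>\<Sigma>_seq n A k\<close> is at least
  \<open>- int (A 2 k)\<close>. The quantity is the share of row \<open>i - 1\<close> in each power
  of \<open>f_j\<close> in \<open>X_k\<close>.\<close>

lemma A2_neg: "k \<le> n \<Longrightarrow> 0 \<le> int (A 2 k) + neg k"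
  using Sigma_rec[of k] pos_neg[of k] pos_neg(2)[of "k + 1"] by linarith

lemma neg_1:
  assumes "i = 1" "k \<le> n"
  shows "neg k = 0"
  using A2_neg[OF assms(2)] support[of 2 k] pos_neg(3)[of k] assms by simp

text \<open>Since \<open>pos k + neg k\<close> is \<open>\<Sigma>_seq n A k\<close>, the recursion
  telescopes over \<open>k..n\<close>.\<close>

lemma pos_neg_sum:
  assumes "k \<le> n + 1" "i \<le> k"
  shows "pos k + neg_sum k = psum n - psum k - (\<Sum>j = k..n. int (A 2 j))"
  using assms
proof (induction k rule: inc_induct)
  case base
  have "psum (n + 1) = psum n" using psum_Suc[of n] support[of 1 "n + 1"] n i by auto
  then show ?case by (simp add: pos_ge neg_sum_gt)
next
  case (step k)
  then show ?case
    using Sigma_rec[of k] pos_neg(1)[of k] neg_sum_step[of k] psum_Suc[of k]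
    by (simp add: sum.atLeast_Suc_atMost)
qed

lemma C_nonneg: "0 \<le> C"
  using path_le[of n] n i_bounds by (simp add: C_def psum_def)

text \<open>If \<open>pos k = 0\<close>, the telescoped identity turns this into the inequality for
  the path crossing in row \<open>k\<close>; otherwise \<open>neg k = 0\<close> and the value is
  that at \<open>k + 1\<close>.\<close>

lemma C_neg_sum:
  assumes "k \<le> n + 1" "i \<le> k"
  shows "0 \<le> C + neg_sum k"
  using assms
proof (induction k rule: inc_induct)
  case base
  show ?case using C_nonneg by (simp add: neg_sum_gt)
next
  case (step k)
  show ?case
  proof (cases "pos k = 0")
    case True
    have "psum k + (\<Sum>j = k..n. int (A 2 j)) \<le> int m"
      using path_le[of k] step by (simp add: psum_def)
    then show ?thesis using True pos_neg_sum[of k] step by (simp add: C_def)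
  next
    case False
    then show ?thesis using step neg_sum_step[of k] pos_neg(4)[of k] by simp
  qed
qed

lemma psum_ge: "n \<le> k \<Longrightarrow> psum k = psum n"
proof (induction k rule: dec_induct)
  case (step k)
  then show ?case using psum_Suc[of k] support[of 1 "k + 1"] n i by auto
qed simp

lemma F_ge: "n \<le> v \<Longrightarrow> F v = int m"
  using psum_ge[of v] by (simp add: F_def pos_ge C_def)

lemma L_gt: "n < v \<Longrightarrow> L v = int m"
  using psum_ge[of "v - 1"] by (simp add: L_def neg_sum_gt C_def)

text \<open>This increment and that of \<open>L\<close> below add up to
  \<open>A 1 v + A 2 v\<close>, the exponent in \<open>X_v\<close>: they are the shares of rows
  \<open>i - 1\<close> and \<open>i\<close> in it.\<close>

lemma F_step: "i \<le> v + 1 \<Longrightarrow> v \<le> n \<Longrightarrow> F (v + 1) - F v = int (A 2 v) + neg v"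
  using psum_Suc[of v] Sigma_rec[of v] pos_neg(1)[of v] by (simp add: F_def)

lemma L_step: "i \<le> v \<Longrightarrow> v \<le> n \<Longrightarrow> L (v + 1) - L v = int (A 1 v) - neg v"
  using psum_minus[of v] neg_sum_step[of v] by (simp add: L_def)

lemma F_mono:
  assumes "i \<le> a + 1" "a \<le> b"
  shows "F a \<le> F b"
  using assms(2)
proof (induction b rule: dec_induct)
  case (step b)
  have "F b \<le> F (b + 1)"
  proof (cases "b \<le> n")
    case True
    then show ?thesis using F_step[of b] A2_neg[of b] assms(1) step(1) by simp
  qed (simp add: F_ge)
  then show ?case using step by simp
qed simp

lemma L_mono:
  assumes "i \<le> a" "a \<le> b"
  shows "L a \<le> L b"
  using assms(2)
proof (induction b rule: dec_induct)
  case (step b)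
  have "L b \<le> L (b + 1)"
  proof (cases "b \<le> n")
    case True
    then show ?thesis using L_step[of b] pos_neg(3)[of b] assms(1) step(1) by simp
  qed (simp add: L_gt)
  then show ?case using step by simp
qed simp

text \<open>
  The cumulative counts of rows \<open>i - 1\<close> and \<open>i\<close> after \<open>X\<^sub>n, \<dots>, X\<^sub>l\<^sub>+\<^sub>1\<close>, followed by the factors of
  \<open>X\<^sub>l\<close> up to and including the power of \<open>f\<^sub>j\<close>.
\<close>

definition level :: "nat \<Rightarrow> nat \<Rightarrow> nat \<Rightarrow> nat" where
  "level l j v = (if v \<le> j then l else max v (l + 1))"
definition upper :: "nat \<Rightarrow> nat \<Rightarrow> nat \<Rightarrow> int" where
  "upper l j v = (if v < i - 1 then 0 else if v = i - 1 then C else F (level l j v))"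
definition lower :: "nat \<Rightarrow> nat \<Rightarrow> nat \<Rightarrow> int" where
  "lower l j v = (if v < i then 0 else if v = i then C + neg_sum l else L (level l j v))"
definition state :: "nat \<Rightarrow> nat \<Rightarrow> nat \<Rightarrow> nat \<Rightarrow> nat" where
  "state l j = fill i m (upper l j) (lower l j)"

lemma level_mono: "j \<le> l \<Longrightarrow> v \<le> v' \<Longrightarrow> level l j v \<le> level l j v'"
  by (auto simp: level_def)

text \<open>\<open>level l j\<close> passes from \<open>max v (l + 1)\<close> to
  \<open>max v l\<close> one letter at a time, since a power of \<open>f_j\<close> changes a count
  at \<open>j\<close> only.\<close>

lemma level_diag: "level k k v = max v k"
  by (auto simp: level_def max_def)

lemma level_ge: "l \<le> level l j v"
  by (auto simp: level_def)

lemma upper_2: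
  "i = 2 \<Longrightarrow> upper l j v = (if v = 0 then 0 else if v = 1 then C else F (level l j v))"
  unfolding upper_def by auto

lemma lower_2:
  "i = 2 \<Longrightarrow> lower l j v = (if v < 2 then 0 else if v = 2 then C + neg_sum l else L (level l j v))"
  unfolding lower_def by auto

lemma cumulative_upper:
  assumes "i = 2" "2 \<le> l" "j \<le> l" "l \<le> n + 1"
  shows "cumulative (n + 1) m (upper l j)"
proof -
  have "upper l j v \<le> upper l j (v + 1)" for v
  proof -
    have "C \<le> F (level l j v)" for v
      using psum_nonneg pos_neg(2) by (simp add: F_def)
    moreover have "F (level l j v) \<le> F (level l j (v + 1))"
      using F_mono[OF _ level_mono[OF assms(3)], of v "v + 1"] level_ge[of l j v] assms by simp
    moreover have "i - 1 = 1" using assms(1) by simp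
    ultimately show ?thesis using C_nonneg by (auto simp: upper_def)
  qed
  then have "mono (upper l j)" by (simp add: mono_iff_le_Suc)
  moreover have "upper l j v = int m" if "n + 1 \<le> v" for v
  proof -
    have "n \<le> level l j v" using that assms(3,4) by (auto simp: level_def)
    moreover have "i - 1 < v" using that n i_bounds by linarith
    ultimately show ?thesis using F_ge by (simp add: upper_def)
  qed
  moreover have "0 < i - 1" using assms(1) by simp
  ultimately show ?thesis by (simp add: cumulative_def upper_def)
qed

lemma cumulative_lower:
  assumes "2 \<le> l" "j \<le> l" "l \<le> n + 1"
  shows "cumulative (n + 1) m (lower l j)"
proof -
  have il: "i \<le> l" using i assms(1) by auto
  have "lower l j v \<le> lower l j (v + 1)" for v
  proof -
    have "C + neg_sum l \<le> L (level l j v)" for v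
      using psum_nonneg[of "l - 1"] L_mono[OF il level_ge, of j v] by (simp add: L_def)
    moreover have "L (level l j v) \<le> L (level l j (v + 1))"
      using L_mono[OF _ level_mono[OF assms(2)], of v "v + 1"] level_ge[of l j v] il by simp
    ultimately show ?thesis using C_neg_sum[of l] il assms by (auto simp: lower_def)
  qed
  then have "mono (lower l j)" by (simp add: mono_iff_le_Suc)
  moreover have "lower l j v = int m" if "n + 1 \<le> v" for v
    using that assms n i_bounds L_gt[of "level l j v"] by (auto simp: lower_def level_def split: if_splits)
  ultimately show ?thesis using i_bounds by (auto simp: cumulative_def lower_def)
qed

section \<open>The action of \<open>G\<close>, \<open>D_l\<close> and the powers of
  \<open>f_j\<close> on the states\<close>

lemma op_G_highest: "op_G n i m A (Some (highest_tab i m)) = Some (state (n + 1) (n + 1))"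
proof -
  define d where "d = (\<Sum>r = i..n. A 1 r)"
  have d: "int d = int m - C" by (simp add: d_def C_def psum_def)
  define X0 where "X0 = (\<lambda>v. if v < i - 1 then 0 else int m)"
  define Y0 where "Y0 = (\<lambda>v. if v < i then 0 else int m)"
  define Y1 where "Y1 = Y0(i := C)"
  have X0: "cumulative (n + 1) m X0" if "i = 2"
    using that n by (auto simp: cumulative_def mono_def X0_def)
  have Y0: "cumulative (n + 1) m Y0"
    using i_bounds n by (auto simp: cumulative_def mono_def Y0_def)
  have Y1: "cumulative (n + 1) m Y1"
    using i_bounds n C_nonneg d by (auto simp: cumulative_def mono_def Y1_def Y0_def)
  have Y1_eq: "lower (n + 1) (n + 1) = Y1"
    using i_bounds
    by (auto simp: lower_def Y1_def Y0_def level_def neg_sum_gt L_gt)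
  \<comment> \<open>Row \<open>i - 1\<close> contains no letter \<open>i\<close>, so all
    \<open>d\<close> steps happen in row \<open>i\<close>.\<close>
  have f_i: "f_pow i m i d (Some (highest_tab i m)) = Some (fill i m X0 Y1)"
  proof -
    have "f_pow i m i d (Some (fill i m X0 Y0)) = Some (fill i m (X0(i := X0 i - 0)) (Y0(i := Y0 i - int d)))"
      by (rule f_pow_fill[OF i Y0 X0])
        (use i_bounds n C_nonneg d in \<open>auto simp: X0_def Y0_def\<close>)
    moreover have "Y0(i := Y0 i - int d) = Y1"
      using d by (simp add: Y1_def Y0_def)
    moreover have "X0(i := X0 i - 0) = X0" by simp
    ultimately show ?thesis
      using highest_tab_eq_fill[OF i, of m, folded X0_def Y0_def] by (simp only:)
  qed
  show ?thesis
  proof (cases "i = 1")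
    case True
    then have "op_G n i m A x = f_pow i m i d x" for x by (simp add: op_G_def d_def)
    moreover have "fill i m X0 Y1 = state (n + 1) (n + 1)"
      unfolding state_def Y1_eq using True fill_1 by metis
    ultimately show ?thesis using f_i by simp
  next
    case False
    then have i2: "i = 2" using i by simp
    have X0_def': "X0 = (\<lambda>v. if v = 0 then 0 else int m)"
      unfolding X0_def using i2 by auto
    have "[1..<i + 1] = [1, i]" by (simp add: i2 upt_rec)
    then have "op_G n i m A x = f_pow i m 1 d (f_pow i m i d x)" for x
      by (simp add: op_G_def d_def)
    \<comment> \<open>The lower row keeps \<open>C\<close> letters \<open>2\<close>, so exactly
      \<open>m - C = d\<close> of the \<open>m\<close> letters \<open>1\<close> above are unpaired,
      and all steps happen in the upper row.\<close>
    moreover have "f_pow i m 1 d (Some (fill i m X0 Y1)) =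
        Some (fill i m (X0(1 := X0 1 - int d)) (Y1(1 := Y1 1 - 0)))"
      by (rule f_pow_fill[OF i Y1 X0])
        (use n C_nonneg d i2 in \<open>auto simp: X0_def Y0_def Y1_def\<close>)
    moreover have "X0(1 := X0 1 - int d) = upper (n + 1) (n + 1)"
    proof
      fix v
      show "(X0(1 := X0 1 - int d)) v = upper (n + 1) (n + 1) v"
        using d F_ge[of "level (n + 1) (n + 1) v"] level_ge[of "n + 1" "n + 1" v]
        by (auto simp: upper_2[OF i2] X0_def' split: if_splits)
    qed
    ultimately show ?thesis using f_i unfolding state_def Y1_eq by simp
  qed
qed

lemma op_D_state:
  assumes l: "2 \<le> l" "l \<le> n"
  shows "op_D i m A l (Some (state (l + 1) (l + 1))) = Some (state l i)"
proof (cases "i = 1")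
  case True
  have "lower (l + 1) (l + 1) = lower l i"
  proof
    fix v
    have "neg_sum l = neg_sum (l + 1)"
      using neg_sum_step[of l] neg_1[OF True] l(2) by simp
    moreover have "level l i v = max v (l + 1)" if "i < v" using that by (simp add: level_def)
    ultimately show "lower (l + 1) (l + 1) v = lower l i v"
      by (simp add: lower_def level_diag)
  qed
  then have "state (l + 1) (l + 1) = state l i"
    unfolding state_def using True fill_1 by metis
  then show ?thesis using True by (simp add: op_D_def)
next
  case False
  then have i2: "i = 2" using i by simp
  have level_i: "level l i v = (if v \<le> 2 then l else max v (l + 1))" for v
    using i2 by (simp add: level_def)
  note upper = upper_2[OF i2] and lower = lower_2[OF i2]
  define X where "X = upper (l + 1) (l + 1)"
  define Y where "Y = lower (l + 1) (l + 1)"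
  \<comment> \<open>If \<Sigma>_l is negative, \<open>p\<close> is the whole surplus of the upper
    row and \<open>q = - \<Sigma>_l\<close> steps remain for the lower row; otherwise
    \<open>q = 0\<close>.\<close>
  define p where "p = int (A 2 l) + neg l"
  define q where "q = - neg l"
  have X: "X 2 = F (l + 1)" "X 1 = C" and Y: "Y 1 = 0" "Y 2 = C + neg_sum (l + 1)" "Y 3 = L (l + 1)"
    using l by (simp_all add: X_def Y_def upper lower level_def)
  \<comment> \<open>The recursion for \<Sigma> originates here: the surplus of letters
    \<open>2\<close> in the upper row is \<open>A 1 (l + 1) + pos (l + 1)\<close>.\<close>
  have gap: "X 2 - X 1 - (Y 3 - Y 2) = \<Sigma>_seq n A l + int (A 2 l)"
    using Sigma_rec[OF l(2)] psum_Suc[of l] l i_bounds unfolding X Y F_def L_def by simp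
  have "f_pow i m 2 (A 2 l) (Some (fill i m X Y)) = Some (fill i m (X(2 := X 2 - p)) (Y(2 := Y 2 - q)))"
  proof (rule f_pow_fill[OF i, where N = "n + 1"])
    show "cumulative (n + 1) m Y" unfolding Y_def by (rule cumulative_lower) (use l in auto)
    show "cumulative (n + 1) m X" unfolding X_def by (rule cumulative_upper) (use l i2 in auto)
    show "int (A 2 l) = p + q" by (simp add: p_def q_def)
    show "0 \<le> p" unfolding p_def using A2_neg l(2) .
    show "p \<le> X 2 - X (2 - 1) - (Y (2 + 1) - Y 2)"
      using gap pos_neg[of l] by (simp add: p_def)
    show "0 \<le> q" using pos_neg(3) by (simp add: q_def)
    \<comment> \<open>The lower row has enough letters \<open>2\<close> because
      \<open>C + neg_sum l\<close> is nonnegative.\<close>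
    show "q \<le> Y 2 - Y (2 - 1)"
    proof -
      have "q \<le> Y 2 - Y 1"
        using C_neg_sum[of l] neg_sum_step[of l] l i_bounds unfolding Y q_def by simp
      then show ?thesis by simp
    qed
    show "q = 0 \<or> p = X 2 - X (2 - 1) - (Y (2 + 1) - Y 2)"
      using gap pos_neg[of l] by (auto simp: p_def q_def)
  qed (use n i2 in auto)
  moreover have "X(2 := X 2 - p) = upper l i"
  proof
    fix v
    show "(X(2 := X 2 - p)) v = upper l i v"
      using X F_step[of l] l i_bounds by (auto simp: p_def X_def upper level_diag level_i)
  qed
  moreover have "Y(2 := Y 2 - q) = lower l i"
  proof
    fix v
    show "(Y(2 := Y 2 - q)) v = lower l i v"
      using Y l neg_sum_step[of l] by (auto simp: q_def Y_def lower level_diag level_i)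
  qed
  moreover have "op_D i m A l x = f_pow i m 2 (A 2 l) x" for x
    using i2 by (simp add: op_D_def)
  ultimately show ?thesis by (simp add: state_def X_def Y_def)
qed

lemma f_pow_state:
  assumes l: "2 \<le> l" "l \<le> n" and j: "i \<le> j" "j < l"
  shows "f_pow i m (j + 1) (\<Sum>p = 1..i. A p l) (Some (state l j)) = Some (state l (j + 1))"
proof -
  define X where "X = upper l j"
  define Y where "Y = lower l j"
  define p where "p = int (A 2 l) + neg l"
  define q where "q = int (A 1 l) - neg l"
  have X: "X (j + 1) - X j = p"
  proof -
    have "i - 1 < j" using j i_bounds by linarith
    then show ?thesis using F_step[of l] l j i_bounds by (simp add: X_def upper_def level_def p_def)
  qed
  \<comment> \<open>Row \<open>i\<close> has no letter \<open>j + 2\<close>, so all \<open>p\<close>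
    letters \<open>j + 1\<close> of row \<open>i - 1\<close> are unpaired and are used up first. For
    \<open>j = i\<close> the bound on \<open>q\<close> has the slack \<open>psum (l - 1)\<close>;
    for larger \<open>j\<close> it is an equality.\<close>
  have Y: "Y (j + 2) = Y (j + 1)" and q: "q \<le> Y (j + 1) - Y j"
    using L_step[of l] l j i_bounds psum_nonneg[of "l - 1"]
    by (auto simp: Y_def lower_def level_def q_def L_def max_def)
  have sum: "(\<Sum>p = 1..i. A p l) = A 1 l + A 2 l"
    using i support[of 2 l] by (auto simp: numeral_2_eq_2)
  have "f_pow i m (j + 1) (\<Sum>p = 1..i. A p l) (Some (fill i m X Y)) =
    Some (fill i m (X(j + 1 := X (j + 1) - p)) (Y(j + 1 := Y (j + 1) - q)))"
  proof (rule f_pow_fill[OF i, where N = "n + 1"])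
    show "cumulative (n + 1) m Y" unfolding Y_def by (rule cumulative_lower) (use l j in auto)
    show "cumulative (n + 1) m X" if "i = 2" unfolding X_def by (rule cumulative_upper) (use l j that in auto)
    show "X (j + 1) = X (j + 1 - 1)" if "i = 1"
      using X neg_1[OF that l(2)] support[of 2 l] that by (simp add: p_def)
    show "int (\<Sum>p = 1..i. A p l) = p + q" unfolding sum by (simp add: p_def q_def)
    show "0 \<le> p" unfolding p_def using A2_neg l(2) .
    show "0 \<le> q" using pos_neg(3)[of l] by (simp add: q_def)
  qed (use X Y q l j in auto)
  moreover have "X(j + 1 := X (j + 1) - p) = upper l (j + 1)"
  proof
    fix v
    show "(X(j + 1 := X (j + 1) - p)) v = upper l (j + 1) v"
      using X j i_bounds by (auto simp: X_def upper_def level_def)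
  qed
  moreover have "Y(j + 1 := Y (j + 1) - q) = lower l (j + 1)"
  proof
    fix v
    show "(Y(j + 1 := Y (j + 1) - q)) v = lower l (j + 1) v"
      using L_step[of l] l j i_bounds by (auto simp: Y_def q_def lower_def level_def)
  qed
  ultimately show ?thesis by (simp add: state_def X_def Y_def)
qed

lemma tab_T_state: "2 \<le> k \<Longrightarrow> k \<le> n \<Longrightarrow> tab_T n i m A k = Some (state k k)"
  by (rule tab_T_eq[where st = "\<lambda>l j. Some (state l j)"])
    (use i_bounds op_G_highest op_D_state f_pow_state in auto)

lemma lower_diag: "lower k k v = (if v < i then 0 else if v = i then C + neg_sum k else L (max v k))"
  by (simp add: lower_def level_diag)

lemma state_ssyt:
  assumes k: "2 \<le> k" "k \<le> n"
  shows "state k k \<in> ssyt n i m"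
proof -
  have Y: "cumulative (n + 1) m (lower k k)" by (rule cumulative_lower) (use k in auto)
  have X: "cumulative (n + 1) m (upper k k)" if "i = 2"
    by (rule cumulative_upper) (use k that in auto)
  define R where "R = (\<lambda>r. if r = i then lower k k else upper k k)"
  have R: "cumulative (n + 1) m (R r)" if "r \<in> {1..i}" for r
  proof (cases "r = i")
    case False
    then have "i = 2" using that i_bounds by auto
    from X[OF this] False show ?thesis by (simp add: R_def)
  qed (use Y in \<open>simp add: R_def\<close>)
  have st: "state k k r c = entry (R r) c" if "r \<in> {1..i}" "c \<in> {1..m}" for r c
    using that by (simp add: state_def fill_def R_def)
  have range: "entry (R r) c \<in> {1..n + 1}" if "r \<in> {1..i}" "c \<in> {1..m}" for r c
  proof -
    have "R r 0 = 0" "R r (n + 1) = int m" using R[OF that(1)] by (auto simp: cumulative_def)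
    then show ?thesis
      using entry_le_iff[OF R[OF that(1)], of c 0] entry_le_iff[OF R[OF that(1)], of c "n + 1"] that
      by auto
  qed
  have rows: "entry (R r) c \<le> entry (R r) (c + 1)" if "r \<in> {1..i}" "c \<in> {1..<m}" for r c
    using entry_le_iff[OF R[OF that(1)], of c "entry (R r) (c + 1)"]
      entry_le_iff[OF R[OF that(1)], of "c + 1" "entry (R r) (c + 1)"] that by auto
  have cols: "entry (R r) c < entry (R (r + 1)) c" if "r \<in> {1..<i}" "c \<in> {1..m}" for r c
  proof -
    have r: "r = 1" "i = 2" using that i_bounds by auto
    note upper = upper_2[OF r(2), of k k, unfolded level_diag]
      and lower = lower_2[OF r(2), of k k, unfolded level_diag]
    \<comment> \<open>Column strictness in terms of counts: row 2 has at most as many entries up to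
      \<open>v + 1\<close> as row 1 has up to \<open>v\<close>.\<close>
    have le: "lower k k (v + 1) \<le> upper k k v" for v
    proof -
      have LF: "L (v + 1) \<le> F v" if "1 \<le> v" for v
        using neg_sum_le[of "v + 1"] pos_neg(2)[of v] by (simp add: L_def F_def)
      consider "v = 0" | "v = 1" | "2 \<le> v" "v < k" | "2 \<le> v" "k \<le> v" by linarith
      then show ?thesis
      proof cases
        case 3
        \<comment> \<open>Below \<open>k\<close> both counts are frozen at their values at
          \<open>k\<close>, so the comparison at \<open>k - 1\<close> is carried over by
          monotonicity of \<open>F\<close>.\<close>
        then have "1 \<le> k - 1" "k - 1 + 1 = k" by auto
        then have "L k \<le> F k"
          using LF[of "k - 1"] F_mono[of "k - 1" k] i_bounds k by simp
        then show ?thesis using 3 by (simp add: upper lower max_def)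
      next
        case 4
        then show ?thesis using LF[of v] by (simp add: upper lower max_def)
      qed (use neg_sum_le[of k] in \<open>simp_all add: upper lower\<close>)
    qed
    define v where "v = entry (R 2) c - 1"
    have v: "entry (R 2) c = v + 1"
      using range[of 2 c] that r by (simp add: v_def)
    then have "int c \<le> lower k k (v + 1)"
      using entry_le_iff[OF Y, of c "v + 1"] that r by (simp add: R_def)
    then have "int c \<le> R 1 v" using le[of v] r by (simp add: R_def)
    then show ?thesis using entry_le_iff[OF R, of 1 c v] that r v by (simp add: numeral_2_eq_2)
  qed
  show ?thesis
    unfolding ssyt_def mem_Collect_eq
  proof (intro conjI)
    show "\<forall>r c. \<not> (1 \<le> r \<and> r \<le> i \<and> 1 \<le> c \<and> c \<le> m) \<longrightarrow> state k k r c = 0"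
      by (auto simp: state_def fill_def)
  qed (use st range rows cols in auto)
qed

section \<open>The states in matrix notation\<close>

lemma tab_matrix_state:
  assumes k: "2 \<le> k" "k \<le> n" and s: "s \<in> {1..i}" and t: "1 \<le> t"
  shows "int (tab_matrix m (state k k) s t) =
    (if s = i then lower k k (s + t - 1) - lower k k (s + t - 2)
     else upper k k (s + t - 1) - upper k k (s + t - 2))"
proof -
  define R where "R = (if s = i then lower k k else upper k k)"
  have R: "cumulative (n + 1) m R"
    unfolding R_def
  proof (cases "s = i")
    case True
    then show "cumulative (n + 1) m (if s = i then lower k k else upper k k)"
      using cumulative_lower[of k k] k by simp
  next
    case False
    then have "i = 2" using s i_bounds by auto
    then show "cumulative (n + 1) m (if s = i then lower k k else upper k k)"
      using False cumulative_upper[of k k] k by simp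
  qed
  have "tab_matrix m (state k k) s t = card {c \<in> {1..m}. entry R c = s + t - 1}"
    unfolding tab_matrix_def
    by (rule arg_cong[where f = card]) (use s in \<open>auto simp: state_def fill_def R_def\<close>)
  moreover have "1 \<le> s + t - 1" using s t by auto
  ultimately show ?thesis using card_entry[OF R, of "s + t - 1"] by (simp add: R_def numeral_2_eq_2)
qed

text \<open>In row 1 the index \<open>t\<close> is the letter itself. The count jumps to
  \<open>C\<close> at \<open>1\<close> and to \<open>F k\<close> at \<open>2\<close>, stays there up
  to \<open>k\<close>, and then follows \<open>F\<close>.\<close>

lemma tab_matrix_upper:
  assumes i2: "i = 2" and k: "2 \<le> k" "k \<le> n" and t: "1 \<le> t" "t \<le> n"
  shows "int (tab_matrix m (state k k) 1 t) =
    (if t = 1 then C else if t = 2 then psum k + pos k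
     else if k + 1 \<le> t then int (A 2 (t - 1)) + neg (t - 1) else 0)"
proof -
  note upper = upper_2[OF i2, of k k, unfolded level_diag]
  have "int (tab_matrix m (state k k) 1 t) = upper k k t - upper k k (t - 1)"
    using tab_matrix_state[OF k, of 1 t] t i2 by (simp add: numeral_2_eq_2)
  moreover consider "t = 1" | "t = 2" | "3 \<le> t" "k + 1 \<le> t" | "3 \<le> t" "t \<le> k"
    using t by linarith
  then have "upper k k t - upper k k (t - 1) = (if t = 1 then C else if t = 2 then psum k + pos k
     else if k + 1 \<le> t then int (A 2 (t - 1)) + neg (t - 1) else 0)"
  proof cases
    case 3
    then have "t = (t - 1) + 1" "k \<le> t - 1" "1 < t - 1" by auto
    then obtain w where w: "t = w + 1" "k \<le> w" "1 < w" by blast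
    then show ?thesis using F_step[of w] t i_bounds by (simp add: upper max_def)
  next
    case 4
    then have "t = (t - 1) + 1" "1 < t - 1" by auto
    then obtain w where w: "t = w + 1" "1 < w" by blast
    then show ?thesis using 4 by (simp add: upper max_def)
  qed (use k in \<open>simp_all add: upper F_def max_def\<close>)
  ultimately show ?thesis by simp
qed

lemma tab_matrix_lower:
  assumes k: "2 \<le> k" "k \<le> n" and t: "1 \<le> t" "t \<le> n - i + 2"
  shows "int (tab_matrix m (state k k) i t) =
    (if t = 1 then C + neg_sum k else if t = 2 \<and> i + 1 \<le> k then psum (k - 1)
     else if k - i + 2 \<le> t then int (A 1 (t + i - 2)) - neg (t + i - 2) else 0)"
proof -
  have il: "i \<le> k" "i \<le> n" using i_bounds k by auto
  have "int (tab_matrix m (state k k) i t) = lower k k (i + t - 1) - lower k k (i + t - 2)"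
    using tab_matrix_state[OF k, of i t] t i_bounds by simp
  moreover consider "t = 1" | "t = 2" "i + 1 \<le> k" | "t = 2" "k = i"
    | "3 \<le> t" "k - i + 2 \<le> t" | "3 \<le> t" "\<not> k - i + 2 \<le> t"
    using il t by linarith
  then have "lower k k (i + t - 1) - lower k k (i + t - 2) =
    (if t = 1 then C + neg_sum k else if t = 2 \<and> i + 1 \<le> k then psum (k - 1)
     else if k - i + 2 \<le> t then int (A 1 (t + i - 2)) - neg (t + i - 2) else 0)"
  proof cases
    case 1
    then show ?thesis using i_bounds by (simp add: lower_diag)
  next
    case 2
    then show ?thesis using i_bounds by (simp add: lower_diag L_def max_def)
  next
    case 3
    \<comment> \<open>With \<open>k = i\<close> the count at \<open>i\<close> already equals
      \<open>L i\<close>, so the entry for \<open>t = 2\<close> is an increment of \<open>L\<close>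
      like the later ones.\<close>
    have "psum (i - 1) = 0" using i_bounds by (simp add: psum_def)
    then have "L i = C + neg_sum k" using 3 by (simp add: L_def)
    then show ?thesis using 3 L_step[of i] il by (simp add: lower_diag max_def)
  next
    case 4
    then have v: "i + t - 1 = (t + i - 2) + 1" "i + t - 2 = t + i - 2" "k \<le> t + i - 2" "i < t + i - 2" "t + i - 2 \<le> n"
      using t il by linarith+
    have "lower k k (i + t - 1) - lower k k (i + t - 2) = L ((t + i - 2) + 1) - L (t + i - 2)"
      unfolding v(1,2) using v(3,4) by (simp add: lower_diag max_def)
    also have "\<dots> = int (A 1 (t + i - 2)) - neg (t + i - 2)"
      by (rule L_step) (use v in auto)
    finally show ?thesis using 4 by simp
  next
    case 5
    then have v: "i + t - 1 \<le> k" "i + t - 2 \<le> k" "i < i + t - 2" "i < i + t - 1" using il by linarith+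
    have "lower k k v = L k" if "i < v" "v \<le> k" for v
      using that by (simp add: lower_diag max_def)
    then have "lower k k (i + t - 1) - lower k k (i + t - 2) = 0"
      using v by simp
    then show ?thesis using 5 by simp
  qed
  ultimately show ?thesis by simp
qed

lemma tab_matrix_formula:
  assumes k: "k \<in> {2..n}" and s: "s \<in> {1..i}" and t: "t \<in> {1..n - i + 2}"
  shows "int (tab_matrix m (state k k) s t) =
    (if s = i - 1 \<and> t = 1 then
       int m - (\<Sum>j = i..n. int (A 1 j))
     else if s = i - 1 \<and> t = 2 then
       (\<Sum>j = 2..k. int (A 1 j)) + (1 - \<chi>_seq n A k) * \<Sigma>_seq n A k
     else if s = i \<and> t = 1 then
       int m - (\<Sum>j = i..n. int (A 1 j)) + (\<Sum>j = k..n. \<chi>_seq n A j * \<Sigma>_seq n A j)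
     else if s = i \<and> t = 2 \<and> k \<ge> i + 1 then
       (\<Sum>j = i..k - 1. int (A 1 j))
     else if s = i - 1 \<and> k + 1 \<le> t \<and> t \<le> n then
       int (A 2 (t - 1)) + \<chi>_seq n A (t - 1) * \<Sigma>_seq n A (t - 1)
     else if s = i \<and> k - i + 2 \<le> t \<and> t \<le> n - i + 2 then
       int (A 1 (t + i - 2)) - \<chi>_seq n A (t + i - 2) * \<Sigma>_seq n A (t + i - 2)
     else 0)"
proof (cases "s = i")
  case True
  then show ?thesis
    using tab_matrix_lower[of k t] k t i_bounds
    unfolding chi_neg chi_pos C_def psum_def neg_sum_def by auto
next
  case False
  then have i2: "i = 2" and s1: "s = 1" using s i_bounds by auto
  have i1: "i - 1 = 1" "i \<noteq> 1" and tn: "t \<le> n" using i2 t n by auto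
  have sum: "(\<Sum>j = 2..k. int (A 1 j)) = psum k" unfolding psum_def using i2 by simp
  have C: "int m - (\<Sum>j = i..n. int (A 1 j)) = C" by (simp add: C_def psum_def)
  show ?thesis
    using tab_matrix_upper[OF i2, of k t] k t tn
    unfolding chi_neg chi_pos sum C s1 i1(1) using i1(2) by auto
qed
end

section \<open>Crystal isomorphisms\<close>

lemma unpaired_snoc:
  "w x = j + 1 \<Longrightarrow> unpaired w j (xs @ [x]) = unpaired w j xs @ [x]"
  by (induction xs) (auto split: list.splits)

lemma reading_cells_split:
  assumes "1 \<le> r" "r \<le> i" "1 \<le> m"
  shows "\<exists>us. reading_cells i m = us @ [(r, m)] @ concat (map (\<lambda>r. map (Pair r) [1..<m + 1]) (rev [1..<r]))"
proof -
  obtain k where k: "i + 1 = r + 1 + k" using assms(2) by (auto simp: le_iff_add)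
  have "[1..<i + 1] = [1..<r] @ [r] @ [r + 1..<i + 1]"
    using assms(1) upt_add_eq_append[of 1 "r" "1 + k"] k by (simp add: upt_conv_Cons del: upt_Suc)
  moreover have "[1..<m + 1] = [1..<m] @ [m]" using assms(3) by simp
  ultimately show ?thesis
    unfolding reading_cells_def by (auto simp del: upt_Suc)
qed

text \<open>Induction over the rows from the top. If the last letter \<open>j + 1\<close> of row
  \<open>r\<close> exceeded \<open>r\<close>, only letters below \<open>r\<close>, hence below
  \<open>j\<close>, would be read after it; it would stay unpaired and \<open>e_j\<close> would be
  defined. Column strictness gives the reverse bound.\<close>

lemma highest_weight_unique:
  assumes T: "T \<in> ssyt n i m" and e: "\<And>j. j \<in> {1..n} \<Longrightarrow> tab_e i m j T = None"
  shows "T = highest_tab i m"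
proof -
  have zero: "\<not> (1 \<le> r \<and> r \<le> i \<and> 1 \<le> c \<and> c \<le> m) \<Longrightarrow> T r c = 0" for r c
    using T by (simp add: ssyt_def)
  have range: "T r c \<in> {1..n + 1}" if "r \<in> {1..i}" "c \<in> {1..m}" for r c
    using T that by (simp add: ssyt_def)
  have col: "T r c < T (r + 1) c" if "r \<in> {1..<i}" "c \<in> {1..m}" for r c
    using T that by (simp add: ssyt_def)
  have row: "T r c \<le> T r m" if "r \<in> {1..i}" "1 \<le> c" "c \<le> m" for r c
    using that(3)
  proof (induction c rule: inc_induct)
    case (step c')
    then have "T r c' \<le> T r (c' + 1)"
      using T that by (simp add: ssyt_def)
    then show ?case using step by simp
  qed simp
  have ge: "r \<le> T r c" if "1 \<le> r" "r \<le> i" "c \<in> {1..m}" for r c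
    using that(1,2)
  proof (induction r rule: dec_induct)
    case base
    then show ?case using range[of 1 c] that(3) by simp
  next
    case (step r)
    then show ?case using col[of r c] that(3) by simp
  qed
  have "\<forall>c\<in>{1..m}. T r c = r" if "1 \<le> r" "r \<le> i" for r
    using that
  proof (induction r rule: less_induct)
    case (less r)
    have "T r m \<le> r" if "1 \<le> m"
    proof (rule ccontr)
      assume "\<not> T r m \<le> r"
      define j where "j = T r m - 1"
      have j: "T r m = j + 1" "r \<le> j" "j \<in> {1..n}"
        using \<open>\<not> T r m \<le> r\<close> range[of r m] less.prems that by (auto simp: j_def)
      define w where "w = (\<lambda>(r, c). T r c)"
      obtain us where us: "reading_cells i m = us @ [(r, m)] @ concat (map (\<lambda>r. map (Pair r) [1..<m + 1]) (rev [1..<r]))"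
        using reading_cells_split less.prems \<open>1 \<le> m\<close> by blast
      have "filter (\<lambda>x. w x = j \<or> w x = j + 1) (concat (map (\<lambda>r. map (Pair r) [1..<m + 1]) (rev [1..<r]))) = []"
      proof -
        have "\<not> (w x = j \<or> w x = j + 1)"
          if x: "x \<in> set (concat (map (\<lambda>r. map (Pair r) [1..<m + 1]) (rev [1..<r])))" for x
        proof -
          obtain r' c where "x = (r', c)" "1 \<le> r'" "r' < r" "c \<in> {1..m}" using x by auto
          then have "w x = r'" using less.IH[of r'] less.prems by (auto simp: w_def)
          then show ?thesis using \<open>r' < r\<close> j(2) by simp
        qed
        then show ?thesis by (simp only: filter_empty_conv) blast
      qed
      then have "filter (\<lambda>x. w x = j \<or> w x = j + 1) (reading_cells i m) =
          filter (\<lambda>x. w x = j \<or> w x = j + 1) us @ [(r, m)]"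
        unfolding us using j(1) by (simp add: w_def)
      then have "(r, m) \<in> set (unpaired_cells i m j T)"
        using unpaired_snoc[of w "(r, m)" j] j(1) by (simp add: unpaired_cells_def w_def Let_def)
      then have "(r, m) \<in> set (filter (\<lambda>(r, c). T r c = j + 1) (unpaired_cells i m j T))"
        using j(1) by simp
      then have "filter (\<lambda>(r, c). T r c = j + 1) (unpaired_cells i m j T) \<noteq> []"
        by (metis empty_iff list.set(1))
      then have "tab_e i m j T \<noteq> None"
        by (simp add: tab_e_def Let_def)
      then show False using e[OF j(3)] by simp
    qed
    then show ?case
      using row[of r] ge[of r] less.prems by (force intro: antisym)
  qed
  then show ?thesis
    using zero by (auto simp: highest_tab_def fun_eq_iff)
qed

lemma zero_mem_kr_arrays: "(\<lambda>p q. 0) \<in> kr_arrays n i m"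
  by (simp add: kr_arrays_def)

lemma crystal_iso_zero:
  assumes "crystal_iso n i m \<phi>"
  shows "\<phi> (\<lambda>p q. 0) = highest_tab i m"
proof (rule highest_weight_unique)
  show "\<phi> (\<lambda>p q. 0) \<in> ssyt n i m"
    using assms zero_mem_kr_arrays by (auto simp: crystal_iso_def bij_betw_def)
  fix j assume "j \<in> {1..n}"
  then have "map_option \<phi> (kr_e n i j (\<lambda>p q. 0)) = tab_e i m j (\<phi> (\<lambda>p q. 0))"
    using assms zero_mem_kr_arrays by (auto simp: crystal_iso_def)
  moreover have "kr_eps n i j (\<lambda>p q. 0) = 0"
    by (simp add: kr_eps_def Let_def)
  ultimately show "tab_e i m j (\<phi> (\<lambda>p q. 0)) = None"
    by (simp add: kr_e_def)
qed

section \<open>Powers of \<open>f_j\<close> in the polytope model\<close>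

lemma f_pow_iso:
  assumes "crystal_iso n i m \<phi>" "j \<in> {1..n}"
    and "\<And>t. t < c \<Longrightarrow> B t \<in> kr_arrays n i m"
    and "\<And>t. t < c \<Longrightarrow> kr_f n i m j (B t) = Some (B (Suc t))"
  shows "f_pow i m j c (Some (\<phi> (B 0))) = Some (\<phi> (B c))"
  using assms(3,4)
proof (induction c)
  case (Suc c)
  have "map_option \<phi> (kr_f n i m j (B c)) = tab_f i m j (\<phi> (B c))"
    using assms(1,2) Suc.prems(1)[of c] by (simp add: crystal_iso_def)
  then show ?case using Suc by (simp add: f_pow_Suc)
qed simp

text \<open>\<open>kr_phi\<close> at \<open>i\<close> is the slack of the path along row
  \<open>i\<close> and then down column \<open>i\<close>. The path meets \<open>(i, i)\<close>, so
  the increased array can satisfy its inequality only if the slack is positive.\<close>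

lemma kr_f_node:
  assumes i: "i \<in> {1, 2}" and n: "2 \<le> n" and B: "upd B i i (B i i + 1) \<in> kr_arrays n i m"
  shows "kr_f n i m i B = Some (upd B i i (B i i + 1))"
proof -
  define B' where "B' = upd B i i (B i i + 1)"
  have le: "(\<Sum>j = i..s. B' 1 j) + (\<Sum>j = s..n. B' 2 j) \<le> m" if "s \<in> {i..n}" for s
    using B that kr_arrays_iff[OF i n, of "upd B i i (B i i + 1)"] by (simp add: B'_def)
  have i_n: "i \<le> n" using i n by auto
  have row: "(\<Sum>j = i..n. B' i j) = (\<Sum>j = i..n. B i j) + 1"
    using i_n by (simp add: sum.atLeast_Suc_atMost B'_def upd_def)
  have "(\<Sum>j = 1..<i. B j i) + (\<Sum>j = i..n. B i j) < m"
  proof (cases "i = 1")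
    case True
    then show ?thesis using le[of n] row i_n by simp
  next
    case False
    then have i2: "i = 2" using i by simp
    then have "(\<Sum>j = i..i. B' 1 j) = (\<Sum>j = 1..<i. B j i)"
      by (simp add: B'_def upd_def numeral_2_eq_2)
    then show ?thesis using le[of i] row i_n i2 by simp
  qed
  then show ?thesis by (simp add: kr_f_def kr_phi_def)
qed

text \<open>For \<open>i = 2\<close> the crossing sums at columns 1 and 2 differ by
  \<open>B 1 l - B 2 (l - 1)\<close>, so \<open>le\<close> makes column 1 the smallest
  maximiser.\<close>

lemma kr_f_row_1:
  assumes i: "i \<in> {1, 2}" and l: "i < l" and le: "B 2 (l - 1) \<le> B 1 l" and B: "0 < B 1 (l - 1)"
  shows "kr_f n i m l B = Some (upd (upd B 1 (l - 1) (B 1 (l - 1) - 1)) 1 l (B 1 l + 1))"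
proof -
  have "1 \<in> row_cross i l B"
    using i le by (auto simp: row_cross_def argmax_set_def numeral_2_eq_2 atLeastAtMostSuc_conv le_Suc_eq)
  moreover have "row_cross i l B \<subseteq> {1..i}"
    by (auto simp: row_cross_def argmax_set_def)
  ultimately have Min: "Min (row_cross i l B) = 1"
    by (intro Min_eqI) (auto intro: finite_subset)
  then have "kr_phi n i m l B = B 1 (l - 1)"
    using l by (simp add: kr_phi_def)
  then show ?thesis using l B Min by (simp add: kr_f_def Let_def)
qed

lemma kr_f_row_2:
  assumes l: "2 < l" and less: "B 1 l < B 2 (l - 1)"
  shows "kr_f n 2 m l B = Some (upd (upd B 2 (l - 1) (B 2 (l - 1) - 1)) 2 l (B 2 l + 1))"
proof -
  have "row_cross 2 l B = {2}"
    using less by (auto simp: row_cross_def argmax_set_def numeral_2_eq_2 atLeastAtMostSuc_conv le_Suc_eq)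
  then have Min: "Min (row_cross 2 l B) = 2" by simp
  then have "kr_phi n 2 m l B = B 1 (l - 1) + B 2 (l - 1) - B 1 l"
    using l by (simp add: kr_phi_def Let_def numeral_2_eq_2)
  then show ?thesis using l less Min by (simp add: kr_f_def Let_def)
qed

text \<open>This is the situation inside \<open>G\<close>. All units lie in row 2, and only a
  crossing there counts both columns in full, so it is the unique maximiser.\<close>

lemma kr_f_col:
  assumes n: "2 \<le> n" and B: "\<And>p q. q \<noteq> 2 \<Longrightarrow> B p q = 0" and pos: "0 < B 2 2"
  shows "kr_f n 2 m 1 B = Some (upd (upd B 2 2 (B 2 2 - 1)) 1 2 (B 1 2 + 1))"
proof -
  have sum: "(\<Sum>j = a..b. B p j) = (if 2 \<in> {a..b} then B p 2 else 0)" for a b p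
  proof -
    have "(\<Sum>j = a..b. B p j) = (\<Sum>j = a..b. if j = 2 then B p 2 else 0)"
      by (rule sum.cong) (auto simp: B)
    then show ?thesis by simp
  qed
  have "col_cross n 2 1 B = {2}"
    using n pos by (auto simp: col_cross_def argmax_set_def sum simp flip: numeral_2_eq_2)
  then have Max: "Max (col_cross n 2 1 B) = 2" by simp
  then have "kr_phi n 2 m 1 B = B 2 2"
    using n by (simp add: kr_phi_def Let_def sum flip: numeral_2_eq_2)
  then show ?thesis using pos Max by (simp add: kr_f_def Let_def flip: numeral_2_eq_2)
qed

section \<open>The arrays reached from the zero array\<close>

context kr_array
begin

text \<open>A path for \<open>B\<close> crossing in a row up to \<open>l\<close> is bounded by the
  path for \<open>A\<close> crossing in row \<open>l\<close>; for a later crossing the paths with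
  the same \<open>s\<close> are compared.\<close>

lemma mem_kr_arrays_below:
  assumes l: "i \<le> l" "l \<le> n"
    and supp: "\<And>p q. \<not> (1 \<le> p \<and> p \<le> i \<and> i \<le> q \<and> q \<le> n) \<Longrightarrow> B p q = 0"
    and above: "\<And>p q. l < q \<Longrightarrow> B p q = A p q"
    and row1: "(\<Sum>j = i..l. B 1 j) \<le> (\<Sum>j = i..l. A 1 j)"
    and row2: "(\<Sum>j = i..l. B 2 j) \<le> A 2 l"
  shows "B \<in> kr_arrays n i m"
proof -
  have A: "(\<Sum>j = i..s. A 1 j) + (\<Sum>j = s..n. A 2 j) \<le> m" if "s \<in> {i..n}" for s
    using A kr_arrays_iff[OF i n] that by auto
  have "(\<Sum>j = i..s. B 1 j) + (\<Sum>j = s..n. B 2 j) \<le> m" if s: "s \<in> {i..n}" for s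
  proof (cases "s \<le> l")
    case True
    have "(\<Sum>j = i..s. B 1 j) \<le> (\<Sum>j = i..l. B 1 j)"
      by (rule sum_mono2) (use True in auto)
    moreover have "(\<Sum>j = s..n. B 2 j) \<le> (\<Sum>j = l..n. A 2 j)"
    proof -
      have "(\<Sum>j = s..n. B 2 j) \<le> (\<Sum>j = i..n. B 2 j)"
        by (rule sum_mono2) (use s in auto)
      also have "\<dots> = (\<Sum>j = i..l. B 2 j) + (\<Sum>j = l + 1..n. B 2 j)"
        using l by (metis sum.ub_add_nat le_SucI le_add_diff_inverse Suc_eq_plus1)
      also have "(\<Sum>j = l + 1..n. B 2 j) = (\<Sum>j = l + 1..n. A 2 j)"
        by (rule sum.cong) (auto simp: above)
      finally show ?thesis using row2 l by (simp add: sum.atLeast_Suc_atMost)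
    qed
    ultimately show ?thesis using row1 A[of l] l by simp
  next
    case False
    have split: "(\<Sum>j = i..s. f j) = (\<Sum>j = i..l. f j) + (\<Sum>j = l + 1..s. f j)" for f :: "nat \<Rightarrow> nat"
      using l False by (metis sum.ub_add_nat le_SucI le_add_diff_inverse Suc_eq_plus1 nat_le_linear)
    have "(\<Sum>j = l + 1..s. B 1 j) = (\<Sum>j = l + 1..s. A 1 j)"
      "(\<Sum>j = s..n. B 2 j) = (\<Sum>j = s..n. A 2 j)"
      by (rule sum.cong; use False in \<open>simp add: above\<close>)+
    then show ?thesis using row1 A[OF s] split[of "B 1"] split[of "A 1"] by simp
  qed
  then show ?thesis using supp kr_arrays_iff[OF i n] by simp
qed

lemma mem_kr_arrays_row_i:
  assumes "\<And>p q. p \<notin> {1..i} \<or> q \<noteq> i \<Longrightarrow> B p q = 0" "B 1 i + B 2 i \<le> m"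
  shows "B \<in> kr_arrays n i m"
proof -
  have sum: "(\<Sum>j = a..b. B p j) \<le> B p i" for a b p
  proof -
    have "(\<Sum>j = a..b. B p j) = (\<Sum>j = a..b. if j = i then B p i else 0)"
      by (rule sum.cong) (auto simp: assms(1))
    then show ?thesis by simp
  qed
  have "(\<Sum>j = i..s. B 1 j) + (\<Sum>j = s..n. B 2 j) \<le> m" for s
    using sum[where a = i and b = s and p = 1] sum[where a = s and b = n and p = 2] assms(2) by linarith
  moreover have "B p q = 0" if "\<not> (1 \<le> p \<and> p \<le> i \<and> i \<le> q \<and> q \<le> n)" for p q
    using that i_bounds n by (intro assms(1)) auto
  ultimately show ?thesis using kr_arrays_iff[OF i n] by simp
qed

text \<open>The counterpart of \<^const>\<open>state\<close> in the polytope model.\<close>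

definition arr :: "nat \<Rightarrow> nat \<Rightarrow> nat \<Rightarrow> nat \<Rightarrow> nat" where
  "arr l j p q = (if l < q then A p q
     else (if q = j then A p l else 0) + (if p = 1 \<and> q = i then \<Sum>r = i..<l. A 1 r else 0))"

text \<open>In \<open>arr l j\<close> the rows beyond \<open>l\<close> are final, the future row
  \<open>l\<close> sits in row \<open>j\<close>, and entry \<open>(1, i)\<close> also stores the
  first column of the rows from \<open>i\<close> to \<open>l - 1\<close>. At
  \<open>l = j = 2\<close> at most \<open>A 1 1\<close> is stored, already in its place.\<close>

lemma arr_2: "arr 2 2 = A"
proof (intro ext)
  fix p q
  show "arr 2 2 p q = A p q"
    using i support[of p q] by (auto simp: arr_def numeral_2_eq_2 le_Suc_eq not_less)
qed

lemma arr_top: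
  "arr (n + 1) (n + 1) = (\<lambda>p q. if p = 1 \<and> q = i then \<Sum>r = i..n. A 1 r else 0)"
proof (intro ext)
  fix p q
  show "arr (n + 1) (n + 1) p q = (if p = 1 \<and> q = i then \<Sum>r = i..n. A 1 r else 0)"
    using support[of p q] support[of p "n + 1"] i_bounds n
    by (simp add: arr_def atLeastLessThanSuc_atLeastAtMost)
qed

lemma op_G_iso:
  assumes iso: "crystal_iso n i m \<phi>"
  shows "op_G n i m A (Some (highest_tab i m)) = Some (\<phi> (arr (n + 1) (n + 1)))"
proof -
  define d where "d = (\<Sum>r = i..n. A 1 r)"
  have d: "d \<le> m"
  proof -
    have "int d \<le> int m" using path_le[of n] i_bounds n by (simp add: d_def)
    then show ?thesis by simp
  qed
  define B where "B = (\<lambda>t. upd (\<lambda>p q. 0) i i t)"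
  have B: "B t \<in> kr_arrays n i m" if "t \<le> m" for t
    by (rule mem_kr_arrays_row_i) (use i that in \<open>auto simp: B_def upd_def\<close>)
  have B0: "B 0 = (\<lambda>p q. 0)" by (simp add: B_def upd_def fun_eq_iff)
  have f_i: "f_pow i m i d (Some (highest_tab i m)) = Some (\<phi> (B d))"
    unfolding crystal_iso_zero[OF iso, symmetric] B0[symmetric]
  proof (rule f_pow_iso[OF iso])
    fix t assume t: "t < d"
    have "upd (B t) i i (B t i i + 1) = B (Suc t)"
      by (simp add: B_def upd_def)
    then show "kr_f n i m i (B t) = Some (B (Suc t))"
      using kr_f_node[OF i n, of "B t" m] B[of "Suc t"] t d by simp
  qed (use B d i_bounds n in auto)
  show ?thesis
  proof (cases "i = 1")
    case True
    then have "op_G n i m A x = f_pow i m i d x" for x by (simp add: op_G_def d_def)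
    moreover have "B d = arr (n + 1) (n + 1)"
      unfolding arr_top B_def upd_def d_def using True by (auto simp: fun_eq_iff)
    ultimately show ?thesis using f_i by simp
  next
    case False
    then have i2: "i = 2" using i by simp
    \<comment> \<open>After \<open>t\<close> steps of \<open>f_1\<close>, \<open>t\<close> of the
      \<open>d\<close> units have moved from column 2 to column 1.\<close>
    define B' where "B' = (\<lambda>t (p::nat) q. if q = i then if p = 1 then t else if p = 2 then d - t else 0 else 0)"
    have B': "B' t \<in> kr_arrays n i m" if "t \<le> d" for t
      by (rule mem_kr_arrays_row_i) (use i2 that d in \<open>auto simp: B'_def\<close>)
    have "[1..<i + 1] = [1, i]" by (simp add: i2 upt_rec)
    then have "op_G n i m A x = f_pow i m 1 d (f_pow i m i d x)" for x
      by (simp add: op_G_def d_def)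
    moreover have "B' 0 = B d"
      using i2 by (auto simp: fun_eq_iff B'_def B_def upd_def)
    moreover have "f_pow i m 1 d (Some (\<phi> (B' 0))) = Some (\<phi> (B' d))"
    proof (rule f_pow_iso[OF iso])
      fix t assume t: "t < d"
      have "upd (upd (B' t) 2 2 (B' t 2 2 - 1)) 1 2 (B' t 1 2 + 1) = B' (Suc t)"
        using t i2 by (auto simp: fun_eq_iff B'_def upd_def)
      then show "kr_f n i m 1 (B' t) = Some (B' (Suc t))"
        using kr_f_col[OF n, of "B' t" m] t i2 by (simp add: B'_def)
    qed (use B' n in auto)
    moreover have "B' d = arr (n + 1) (n + 1)"
      unfolding arr_top B'_def d_def by (auto simp: fun_eq_iff)
    ultimately show ?thesis using f_i by simp
  qed
qed

lemma sum_psum: "i \<le> l \<Longrightarrow> (\<Sum>r = i..l. A 1 r) = (\<Sum>r = i..<l. A 1 r) + A 1 l"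
  by (simp add: atLeastLessThanSuc_atLeastAtMost[symmetric])

lemma op_D_iso:
  assumes iso: "crystal_iso n i m \<phi>" and l: "2 \<le> l" "l \<le> n"
  shows "op_D i m A l (Some (\<phi> (arr (l + 1) (l + 1)))) = Some (\<phi> (arr l i))"
proof -
  have il: "i \<le> l" using i_bounds l by simp
  show ?thesis
  proof (cases "i = 1")
    case True
    have "arr (l + 1) (l + 1) = arr l i"
    proof (intro ext)
      fix p q
      show "arr (l + 1) (l + 1) p q = arr l i p q"
        unfolding arr_def using True l il support[of p l] by (cases "q = l + 1") auto
    qed
    then show ?thesis using True by (simp add: op_D_def)
  next
    case False
    then have i2: "i = 2" using i by simp
    \<comment> \<open>The store at \<open>(1, 2)\<close> already contains \<open>A 1 l\<close>, so
      \<open>D_l\<close> only has to create the \<open>A 2 l\<close> units of the second column at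
      \<open>(2, 2)\<close>.\<close>
    define B where "B = (\<lambda>t. upd (arr (l + 1) (l + 1)) 2 2 t)"
    have B: "B t \<in> kr_arrays n i m" if "t \<le> A 2 l" for t
    proof (rule mem_kr_arrays_below[OF il l(2)])
      show "B t p q = 0" if "\<not> (1 \<le> p \<and> p \<le> i \<and> i \<le> q \<and> q \<le> n)" for p q
        unfolding B_def arr_def upd_def using that support[of p q] l i2
        by (cases "q = l + 1") auto
      show "B t p q = A p q" if "l < q" for p q
        unfolding B_def arr_def upd_def using that l by (cases "q = l + 1") auto
      have "(\<Sum>j = i..l. B t 1 j) = (\<Sum>j = i..l. if j = i then \<Sum>r = i..l. A 1 r else 0)"
        by (rule sum.cong) (auto simp: B_def arr_def upd_def atLeastLessThanSuc_atLeastAtMost)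
      then show "(\<Sum>j = i..l. B t 1 j) \<le> (\<Sum>j = i..l. A 1 j)" using il by simp
      have "(\<Sum>j = i..l. B t 2 j) = (\<Sum>j = i..l. if j = 2 then t else 0)"
        by (rule sum.cong) (auto simp: B_def arr_def upd_def)
      then show "(\<Sum>j = i..l. B t 2 j) \<le> A 2 l" using that by simp
    qed
    have "f_pow i m i (A 2 l) (Some (\<phi> (B 0))) = Some (\<phi> (B (A 2 l)))"
    proof (rule f_pow_iso[OF iso])
      fix t assume t: "t < A 2 l"
      have "upd (B t) i i (B t i i + 1) = B (Suc t)"
        using i2 by (simp add: B_def upd_def)
      then show "kr_f n i m i (B t) = Some (B (Suc t))"
        using kr_f_node[OF i n, of "B t" m] B[of "Suc t"] t by simp
    qed (use B i_bounds n in auto)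
    moreover have "B 0 = arr (l + 1) (l + 1)"
      unfolding B_def arr_def upd_def using l i2 by (auto simp: fun_eq_iff)
    moreover have "B (A 2 l) = arr l i"
    proof (intro ext)
      fix p q
      show "B (A 2 l) p q = arr l i p q"
        unfolding B_def arr_def upd_def using l i2 support[of p l]
        by (cases "q = l + 1"; cases "p = 2") auto
    qed
    ultimately show ?thesis using i2 by (simp add: op_D_def)
  qed
qed

lemma f_pow_arr:
  assumes iso: "crystal_iso n i m \<phi>" and l: "2 \<le> l" "l \<le> n" and j: "i \<le> j" "j < l"
  shows "f_pow i m (j + 1) (\<Sum>p = 1..i. A p l) (Some (\<phi> (arr l j))) = Some (\<phi> (arr l (j + 1)))"
proof -
  have il: "i \<le> l" using j by simp
  define x where "x = (\<Sum>r = i..<l. A 1 r)"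
  \<comment> \<open>\<open>e t p\<close> units of column \<open>p\<close> have moved to row
    \<open>j + 1\<close> after \<open>t\<close> steps: column 2 is emptied first, then column
    1.\<close>
  define e where "e = (\<lambda>t p::nat. if p = 1 then t - A 2 l else if p = 2 then min t (A 2 l) else 0)"
  define B where "B = (\<lambda>t p q. if l < q then A p q
     else (if q = j then A p l - e t p else 0) + (if q = j + 1 then e t p else 0)
       + (if p = 1 \<and> q = i then x else 0))"
  have sum: "(\<Sum>p = 1..i. A p l) = A 1 l + A 2 l"
    using i support[of 2 l] by (auto simp: numeral_2_eq_2)
  have supp2: "A 2 l = 0" if "i = 1" using support[of 2 l] that by simp
  have e1: "e t 1 \<le> A 1 l" "e t 2 \<le> A 2 l" if "t \<le> A 1 l + A 2 l" for t
    using that by (auto simp: e_def)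
  have B: "B t \<in> kr_arrays n i m" if t: "t \<le> A 1 l + A 2 l" for t
  proof (rule mem_kr_arrays_below[OF il l(2)])
    show "B t p q = 0" if "\<not> (1 \<le> p \<and> p \<le> i \<and> i \<le> q \<and> q \<le> n)" for p q
    proof -
      have "A p l = 0" "e t p = 0" if "p \<notin> {1..i}"
        using that support[of p l] supp2 i by (auto simp: e_def)
      then show ?thesis using that support[of p q] l j i_bounds by (auto simp: B_def)
    qed
    have s: "(\<Sum>q = i..l. B t p q) = A p l - e t p + e t p + (if p = 1 then x else 0)" for p
    proof -
      have "(\<Sum>q = i..l. B t p q) = (\<Sum>q = i..l. (if q = j then A p l - e t p else 0)
          + (if q = j + 1 then e t p else 0) + (if q = i then (if p = 1 then x else 0) else 0))"
        by (rule sum.cong) (auto simp: B_def)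
      then show ?thesis using j il by (simp add: sum.distrib)
    qed
    show "(\<Sum>q = i..l. B t 1 q) \<le> (\<Sum>q = i..l. A 1 q)"
      using s[of 1] e1[OF t] sum_psum[OF il] by (simp add: x_def)
    show "(\<Sum>q = i..l. B t 2 q) \<le> A 2 l"
      using s[of 2] e1[OF t] by simp
  qed (simp add: B_def)
  have "f_pow i m (j + 1) (A 1 l + A 2 l) (Some (\<phi> (B 0))) = Some (\<phi> (B (A 1 l + A 2 l)))"
  proof (rule f_pow_iso[OF iso])
    fix t assume t: "t < A 1 l + A 2 l"
    show "kr_f n i m (j + 1) (B t) = Some (B (Suc t))"
    proof (cases "t < A 2 l")
      case True
      then have i2: "i = 2" using supp2 i by auto
      have "B t 1 (j + 1) < B t 2 j"
        using True j by (simp add: B_def e_def)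
      \<comment> \<open>While column 2 still has units in row \<open>j\<close>, column 1 of row
        \<open>j + 1\<close> is empty, which gives the strict comparison selecting column 2.\<close>
      moreover have "upd (upd (B t) 2 j (B t 2 j - 1)) 2 (j + 1) (B t 2 (j + 1) + 1) = B (Suc t)"
        using True j by (auto simp: fun_eq_iff B_def e_def upd_def)
      ultimately show ?thesis
        using kr_f_row_2[of "j + 1" "B t" n m] j i2 by simp
    next
      case False
      have "B t 2 j \<le> B t 1 (j + 1)" "0 < B t 1 j"
        using False t j by (auto simp: B_def e_def)
      moreover have "upd (upd (B t) 1 j (B t 1 j - 1)) 1 (j + 1) (B t 1 (j + 1) + 1) = B (Suc t)"
        using False t j by (auto simp: fun_eq_iff B_def e_def upd_def)
      ultimately show ?thesis
        using kr_f_row_1[OF i, of "j + 1" "B t" n m] j by simp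
    qed
  qed (use B j l in auto)
  moreover have "B 0 = arr l j"
    using j by (auto simp: fun_eq_iff B_def e_def arr_def x_def)
  moreover have "B (A 1 l + A 2 l) = arr l (j + 1)"
    using j i support[of _ l] by (auto simp: fun_eq_iff B_def e_def arr_def x_def)
  ultimately show ?thesis by (simp only: sum)
qed

lemma tab_T_iso:
  assumes "crystal_iso n i m \<phi>"
  shows "tab_T n i m A 2 = Some (\<phi> A)"
proof -
  have "tab_T n i m A 2 = Some (\<phi> (arr 2 2))"
    by (rule tab_T_eq[where st = "\<lambda>l j. Some (\<phi> (arr l j))"])
      (use i_bounds n op_G_iso op_D_iso f_pow_arr assms in auto)
  then show ?thesis by (simp only: arr_2)
qed

end

theorem theorem4p3:
  fixes n i m :: nat and A :: "nat \<Rightarrow> nat \<Rightarrow> nat"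
  assumes "n \<ge> 4" and "i \<in> {1, 2}" and "m \<ge> 1" and "A \<in> kr_arrays n i m"
  shows "(\<forall>k\<in>{2..n}. \<exists>T. tab_T n i m A k = Some T \<and> T \<in> ssyt n i m \<and>
            (\<forall>s\<in>{1..i}. \<forall>t\<in>{1..n - i + 2}.
               int (tab_matrix m T s t) =
                 (if s = i - 1 \<and> t = 1 then
                    int m - (\<Sum>j = i..n. int (A 1 j))
                  else if s = i - 1 \<and> t = 2 then
                    (\<Sum>j = 2..k. int (A 1 j)) + (1 - \<chi>_seq n A k) * \<Sigma>_seq n A k
                  else if s = i \<and> t = 1 then
                    int m - (\<Sum>j = i..n. int (A 1 j)) + (\<Sum>j = k..n. \<chi>_seq n A j * \<Sigma>_seq n A j)
                  else if s = i \<and> t = 2 \<and> k \<ge> i + 1 then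
                    (\<Sum>j = i..k - 1. int (A 1 j))
                  else if s = i - 1 \<and> k + 1 \<le> t \<and> t \<le> n then
                    int (A 2 (t - 1)) + \<chi>_seq n A (t - 1) * \<Sigma>_seq n A (t - 1)
                  else if s = i \<and> k - i + 2 \<le> t \<and> t \<le> n - i + 2 then
                    int (A 1 (t + i - 2)) - \<chi>_seq n A (t + i - 2) * \<Sigma>_seq n A (t + i - 2)
                  else 0)))
         \<and> (\<forall>\<phi>. crystal_iso n i m \<phi> \<longrightarrow> tab_T n i m A 2 = Some (\<phi> A))"
proof -
  interpret kr_array n i m A
    using assms by unfold_locales auto
  have "tab_T n i m A k = Some (state k k)" "state k k \<in> ssyt n i m" if "k \<in> {2..n}" for k
    using that tab_T_state state_ssyt by auto
  then show ?thesis
    using tab_matrix_formula tab_T_iso by blast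
qed

end
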